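(* For a bounded abelian group $G$ the following are equivalent: (a) $G$ admits a minimally almost periodic Hausdorff group topology; (b) $G$ is $\mathfrak{Z}$-connected; (c) all leading Ulm-Kaplansky invariants of $G$ are infinite.
   Context: An abelian group $G$ is bounded (has finite exponent) if $mG=\{0\}$ for some integer $m\ge 1$. A character of a topological abelian group is a continuous homomorphism into the circle group $\mathbb{T}=\mathbb{R}/\mathbb{Z}$; a topological abelian group is minimally almost periodic if all its characters are trivial. The Zariski (Markov-Zariski) topology $\mathfrak{Z}_G$ of an abelian group $G$ is the topology whose closed sets are the algebraic subsets of $G$, i.e. arbitrary intersections of finite unions of sets of the form $\{x\in G: nx=a\}$ with $n\in\mathbb{Z}$, $a\in G$. (For abelian groups these are known to be exactly the unconditionally closed sets, i.e. the sets closed in every Hausdorff group topology on $G$.) $G$ is $\mathfrak{Z}$-connected if the space $(G,\mathfrak{Z}_G)$ is connected. A non-trivial bounded abelian group is a direct sum of cyclic groups $G=\bigoplus_{p\in\pi(G)}\bigoplus_{i=1}^{m_p}\mathbb{Z}(p^i)^{(\alpha_{p,i})}$, where $\pi(G)$ is a non-empty finite set of primes, $\mathbb{Z}(p^i)$ is the cyclic group of order $p^i$, $A^{(\alpha)}$ denotes the direct sum of $\alpha$ copies of $A$, and the $\alpha_{p,i}$ are cardinals, possibly zero, with $\alpha_{p,m_p}>0$. The cardinals $\alpha_{p,i}$ are the Ulm-Kaplansky invariants of $G$ and the cardinals $\alpha_{p,m_p}$, $p\in\pi(G)$, are the leading Ulm-Kaplansky invariants. (The trivial group has no leading invariants, so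 (c) holds vacuously for it.) *)

theory Defs
  imports
    "HOL-Analysis.Analysis"
    "HOL-Algebra.Elementary_Groups"
    "HOL-Algebra.Product_Groups"
begin

text \<open>Abelian groups are HOL-Algebra groups \<open>comm_group G\<close>, hence written multiplicatively:
  \<open>n x\<close> becomes \<open>x [^]\<^bsub>G\<^esub> n\<close>.\<close>

definition bounded_group :: "('a, 'b) monoid_scheme \<Rightarrow> bool" where
  "bounded_group G \<longleftrightarrow> (\<exists>m::nat. m \<ge> 1 \<and> (\<forall>x\<in>carrier G. x [^]\<^bsub>G\<^esub> m = \<one>\<^bsub>G\<^esub>))"


subsection \<open>Topological groups and characters\<close>

definition group_topology :: "('a, 'b) monoid_scheme \<Rightarrow> 'a topology \<Rightarrow> bool" where
  "group_topology G T \<longleftrightarrow>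
     topspace T = carrier G \<and>
     continuous_map (prod_topology T T) T (\<lambda>(x, y). x \<otimes>\<^bsub>G\<^esub> y) \<and>
     continuous_map T T (\<lambda>x. inv\<^bsub>G\<^esub> x)"

definition real_group :: "real monoid" where
  "real_group = \<lparr>carrier = UNIV, monoid.mult = (+), one = 0\<rparr>"

definition circle_group :: "real set monoid" where
  "circle_group = real_group Mod \<int>"

definition circle_proj :: "real \<Rightarrow> real set" where
  "circle_proj x = \<int> #>\<^bsub>real_group\<^esub> x"

definition circle_topology :: "real set topology" where
  "circle_topology =
     topology (\<lambda>U. U \<subseteq> carrier circle_group \<and> open {x. circle_proj x \<in> U})"

lemma openin_circle_topology:
  "openin circle_topology U \<longleftrightarrow> U \<subseteq> carrier circle_group \<and> open {x. circle_proj x \<in> U}"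
proof -
  have "istopology (\<lambda>U. U \<subseteq> carrier circle_group \<and> open {x. circle_proj x \<in> U})"
    unfolding istopology_def
  proof (intro conjI allI impI)
    fix S T
    assume "S \<subseteq> carrier circle_group \<and> open {x. circle_proj x \<in> S}"
      and "T \<subseteq> carrier circle_group \<and> open {x. circle_proj x \<in> T}"
    then show "S \<inter> T \<subseteq> carrier circle_group" "open {x. circle_proj x \<in> S \<inter> T}"
      by (auto intro: open_Collect_conj)
  next
    fix \<K>
    assume *: "\<forall>K\<in>\<K>. K \<subseteq> carrier circle_group \<and> open {x. circle_proj x \<in> K}"
    then show "\<Union>\<K> \<subseteq> carrier circle_group" by blast
    have "{x. circle_proj x \<in> \<Union>\<K>} = (\<Union>K\<in>\<K>. {x. circle_proj x \<in> K})" by blast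
    then show "open {x. circle_proj x \<in> \<Union>\<K>}" using * by auto
  qed
  then show ?thesis by (simp add: circle_topology_def topology_inverse')
qed

lemma carrier_circle_group: "carrier circle_group = range circle_proj"
  by (auto simp: circle_group_def FactGroup_def RCOSETS_def circle_proj_def real_group_def)

lemma topspace_circle_topology: "topspace circle_topology = carrier circle_group"
proof -
  have "openin circle_topology (carrier circle_group)"
    by (simp add: openin_circle_topology carrier_circle_group)
  moreover have "topspace circle_topology \<subseteq> carrier circle_group"
    using openin_circle_topology[of "topspace circle_topology"] by simp
  ultimately show ?thesis
    by (simp add: openin_subset subset_antisym)
qed

lemma quotient_map_circle_proj: "quotient_map euclidean circle_topology circle_proj"
  by (auto simp: quotient_map_def topspace_circle_topology openin_circle_topology
      carrier_circle_group)

definition character :: "('a, 'b) monoid_scheme \<Rightarrow> 'a topology \<Rightarrow> ('a \<Rightarrow> real set) \<Rightarrow> bool" where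
  "character G T h \<longleftrightarrow> h \<in> hom G circle_group \<and> continuous_map T circle_topology h"

definition minimally_almost_periodic :: "('a, 'b) monoid_scheme \<Rightarrow> 'a topology \<Rightarrow> bool" where
  "minimally_almost_periodic G T \<longleftrightarrow>
     (\<forall>h. character G T h \<longrightarrow> (\<forall>x\<in>carrier G. h x = \<one>\<^bsub>circle_group\<^esub>))"


subsection \<open>The Zariski topology\<close>

definition elementary_algebraic :: "('a, 'b) monoid_scheme \<Rightarrow> 'a set \<Rightarrow> bool" where
  "elementary_algebraic G E \<longleftrightarrow>
     (\<exists>n::int. \<exists>a\<in>carrier G. E = {x \<in> carrier G. x [^]\<^bsub>G\<^esub> n = a})"

text \<open>Intersecting with the carrier makes the empty intersection equal to \<open>G\<close>.\<close>

definition algebraic_set :: "('a, 'b) monoid_scheme \<Rightarrow> 'a set \<Rightarrow> bool" where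
  "algebraic_set G C \<longleftrightarrow>
     (\<exists>\<F>. (\<forall>\<E>\<in>\<F>. finite \<E> \<and> (\<forall>E\<in>\<E>. elementary_algebraic G E)) \<and>
          C = carrier G \<inter> (\<Inter>\<E>\<in>\<F>. \<Union>\<E>))"

definition zariski_topology :: "('a, 'b) monoid_scheme \<Rightarrow> 'a topology" where
  "zariski_topology G =
     topology (\<lambda>U. U \<subseteq> carrier G \<and> algebraic_set G (carrier G - U))"

lemma algebraic_set_subset: "algebraic_set G C \<Longrightarrow> C \<subseteq> carrier G"
  by (auto simp: algebraic_set_def)

lemma algebraic_set_iff:
  "algebraic_set G C \<longleftrightarrow> C \<subseteq> carrier G \<and>
     (\<forall>x\<in>carrier G - C. \<exists>\<E>. finite \<E> \<and> (\<forall>E\<in>\<E>. elementary_algebraic G E) \<and>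
        C \<subseteq> \<Union>\<E> \<and> x \<notin> \<Union>\<E>)"
  (is "?L \<longleftrightarrow> ?R")
proof
  assume ?L
  then obtain \<F> where F: "\<And>\<E>. \<E> \<in> \<F> \<Longrightarrow> finite \<E> \<and> (\<forall>E\<in>\<E>. elementary_algebraic G E)"
      and C: "C = carrier G \<inter> (\<Inter>\<E>\<in>\<F>. \<Union>\<E>)"
    unfolding algebraic_set_def by blast
  show ?R
  proof (intro conjI ballI)
    show "C \<subseteq> carrier G" unfolding C by (rule Int_lower1)
    fix x assume "x \<in> carrier G - C"
    then obtain \<E> where E: "\<E> \<in> \<F>" "x \<notin> \<Union>\<E>" unfolding C by blast
    have "C \<subseteq> \<Union>\<E>" unfolding C using E(1) by blast
    with E F[OF E(1)] show "\<exists>\<E>. finite \<E> \<and> (\<forall>E\<in>\<E>. elementary_algebraic G E) \<and>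
        C \<subseteq> \<Union>\<E> \<and> x \<notin> \<Union>\<E>" by (intro exI[of _ \<E>]) simp
  qed
next
  assume R: ?R
  let ?F = "{\<E>. finite \<E> \<and> (\<forall>E\<in>\<E>. elementary_algebraic G E) \<and> C \<subseteq> \<Union>\<E>}"
  have "C = carrier G \<inter> (\<Inter>\<E>\<in>?F. \<Union>\<E>)"
  proof
    show "C \<subseteq> carrier G \<inter> (\<Inter>\<E>\<in>?F. \<Union>\<E>)" using R by blast
    show "carrier G \<inter> (\<Inter>\<E>\<in>?F. \<Union>\<E>) \<subseteq> C"
    proof
      fix x assume x: "x \<in> carrier G \<inter> (\<Inter>\<E>\<in>?F. \<Union>\<E>)"
      show "x \<in> C"
      proof (rule ccontr)
        assume "x \<notin> C"
        with IntD1[OF x] have xC: "x \<in> carrier G - C" by (rule DiffI)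
        obtain \<E> where E: "finite \<E>"
            "\<forall>E\<in>\<E>. elementary_algebraic G E" "C \<subseteq> \<Union>\<E>" "x \<notin> \<Union>\<E>"
          using bspec[OF conjunct2[OF R] xC] by (elim exE conjE) (rule that)
        then have "\<E> \<in> ?F" by simp
        then have "x \<in> \<Union>\<E>" using IntD2[OF x] by (rule INT_D[rotated])
        with E(4) show False by contradiction
      qed
    qed
  qed
  moreover have "\<forall>\<E>\<in>?F. finite \<E> \<and> (\<forall>E\<in>\<E>. elementary_algebraic G E)"
    by simp
  ultimately show ?L unfolding algebraic_set_def by (intro exI[of _ ?F] conjI)
qed

lemma algebraic_set_Un:
  assumes "algebraic_set G C" "algebraic_set G D"
  shows "algebraic_set G (C \<union> D)"
  unfolding algebraic_set_iff
proof (intro conjI ballI)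
  show "C \<union> D \<subseteq> carrier G" using assms algebraic_set_subset by (metis Un_least)
  fix x assume x: "x \<in> carrier G - (C \<union> D)"
  obtain \<E> where E: "finite \<E>" "\<forall>E\<in>\<E>. elementary_algebraic G E" "C \<subseteq> \<Union>\<E>" "x \<notin> \<Union>\<E>"
    using assms(1) x unfolding algebraic_set_iff by blast
  obtain \<H> where H: "finite \<H>" "\<forall>E\<in>\<H>. elementary_algebraic G E" "D \<subseteq> \<Union>\<H>" "x \<notin> \<Union>\<H>"
    using assms(2) x unfolding algebraic_set_iff by blast
  show "\<exists>\<E>. finite \<E> \<and> (\<forall>E\<in>\<E>. elementary_algebraic G E) \<and> C \<union> D \<subseteq> \<Union>\<E> \<and> x \<notin> \<Union>\<E>"
    using E H by (intro exI[of _ "\<E> \<union> \<H>"]) auto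
qed

lemma algebraic_set_Inter:
  assumes "\<And>C. C \<in> \<C> \<Longrightarrow> algebraic_set G C"
  shows "algebraic_set G (carrier G \<inter> \<Inter>\<C>)"
  unfolding algebraic_set_iff
proof (intro conjI ballI)
  show "carrier G \<inter> \<Inter>\<C> \<subseteq> carrier G" by (rule Int_lower1)
  fix x assume "x \<in> carrier G - carrier G \<inter> \<Inter>\<C>"
  then obtain C where C: "C \<in> \<C>" "x \<in> carrier G - C" by blast
  then obtain \<E> where E: "finite \<E>" "\<forall>E\<in>\<E>. elementary_algebraic G E" "C \<subseteq> \<Union>\<E>" "x \<notin> \<Union>\<E>"
    using assms[OF C(1)] unfolding algebraic_set_iff by blast
  have "carrier G \<inter> \<Inter>\<C> \<subseteq> \<Union>\<E>" using C(1) E(3) by blast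
  with E show "\<exists>\<E>. finite \<E> \<and> (\<forall>E\<in>\<E>. elementary_algebraic G E) \<and>
      carrier G \<inter> \<Inter>\<C> \<subseteq> \<Union>\<E> \<and> x \<notin> \<Union>\<E>"
    by (intro exI[of _ \<E>]) simp
qed

lemma openin_zariski_topology:
  "openin (zariski_topology G) U \<longleftrightarrow> U \<subseteq> carrier G \<and> algebraic_set G (carrier G - U)"
proof -
  have "istopology (\<lambda>U. U \<subseteq> carrier G \<and> algebraic_set G (carrier G - U))"
    unfolding istopology_def
  proof (intro conjI allI impI)
    fix S T
    assume *: "S \<subseteq> carrier G \<and> algebraic_set G (carrier G - S)"
      "T \<subseteq> carrier G \<and> algebraic_set G (carrier G - T)"
    then show "S \<inter> T \<subseteq> carrier G" by blast
    have "carrier G - S \<inter> T = (carrier G - S) \<union> (carrier G - T)" by blast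
    then show "algebraic_set G (carrier G - S \<inter> T)"
      using * algebraic_set_Un by metis
  next
    fix \<K>
    assume *: "\<forall>K\<in>\<K>. K \<subseteq> carrier G \<and> algebraic_set G (carrier G - K)"
    then show "\<Union>\<K> \<subseteq> carrier G" by blast
    have "carrier G - \<Union>\<K> = carrier G \<inter> \<Inter>((\<lambda>K. carrier G - K) ` \<K>)" by blast
    moreover have "algebraic_set G (carrier G \<inter> \<Inter>((\<lambda>K. carrier G - K) ` \<K>))"
    proof (rule algebraic_set_Inter)
      fix C assume "C \<in> (\<lambda>K. carrier G - K) ` \<K>"
      then obtain K where "K \<in> \<K>" "C = carrier G - K" by (rule imageE)
      with * show "algebraic_set G C" by simp
    qed
    ultimately show "algebraic_set G (carrier G - \<Union>\<K>)" by (simp only:)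
  qed
  then show ?thesis by (simp add: zariski_topology_def topology_inverse')
qed

lemma algebraic_set_empty: "algebraic_set G {}"
  unfolding algebraic_set_def by (intro exI[of _ "{{}}"]) auto

lemma topspace_zariski_topology: "topspace (zariski_topology G) = carrier G"
proof -
  have "openin (zariski_topology G) (carrier G)"
    by (simp add: openin_zariski_topology algebraic_set_empty)
  moreover have "topspace (zariski_topology G) \<subseteq> carrier G"
    using openin_zariski_topology[of G "topspace (zariski_topology G)"] by simp
  ultimately show ?thesis
    by (simp add: openin_subset subset_antisym)
qed

lemma closedin_zariski_topology: "closedin (zariski_topology G) C \<longleftrightarrow> algebraic_set G C"
proof -
  have "C \<subseteq> carrier G \<Longrightarrow> carrier G - (carrier G - C) = C" by blast
  then show ?thesis
    using algebraic_set_subset[of G C]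
    unfolding closedin_def topspace_zariski_topology openin_zariski_topology
    by (metis Diff_subset)
qed

definition zariski_connected :: "('a, 'b) monoid_scheme \<Rightarrow> bool" where
  "zariski_connected G \<longleftrightarrow> connected_space (zariski_topology G)"


subsection \<open>Ulm-Kaplansky invariants\<close>

text \<open>The direct sum over \<open>p \<in> P\<close> and \<open>1 \<le> i \<le> m p\<close> of copies of the cyclic group of
  order \<open>p ^ i\<close>, one copy for each element of \<open>A p i\<close>.\<close>

definition cyclic_sum ::
    "nat set \<Rightarrow> (nat \<Rightarrow> nat) \<Rightarrow> (nat \<Rightarrow> nat \<Rightarrow> 'c set) \<Rightarrow> (nat \<times> nat \<times> 'c \<Rightarrow> int) monoid" where
  "cyclic_sum P m A =
     sum_group (SIGMA p:P. SIGMA i:{1..m p}. A p i) (\<lambda>(p, i, _). integer_mod_group (p ^ i))"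

text \<open>The cardinal \<open>\<alpha>\<^sub>p\<^sub>,\<^sub>i\<close> is the cardinality of the index set \<open>A p i\<close>. Index sets are drawn
  from the element type of \<open>G\<close>: the generators of distinct summands are distinct elements
  of \<open>G\<close>, so this excludes no cardinal. \<open>P\<close> is empty exactly for the trivial group.\<close>

definition cyclic_decomposition ::
    "('a, 'b) monoid_scheme \<Rightarrow> nat set \<Rightarrow> (nat \<Rightarrow> nat) \<Rightarrow> (nat \<Rightarrow> nat \<Rightarrow> 'a set) \<Rightarrow> bool" where
  "cyclic_decomposition G P m A \<longleftrightarrow>
     finite P \<and> (\<forall>p\<in>P. Factorial_Ring.prime p \<and> m p \<ge> 1 \<and> A p (m p) \<noteq> {}) \<and>
     G \<cong> cyclic_sum P m A"

text \<open>Cardinals are represented as in the HOL cardinal library, by the relation \<open>card_of\<close>.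
  A bounded abelian group has a decomposition, and any two have the same invariants.\<close>

definition leading_UK_invariant :: "('a, 'b) monoid_scheme \<Rightarrow> nat \<Rightarrow> 'a rel \<Rightarrow> bool" where
  "leading_UK_invariant G p \<kappa> \<longleftrightarrow>
     (\<exists>P m A. cyclic_decomposition G P m A \<and> p \<in> P \<and> \<kappa> = card_of (A p (m p)))"

end

theory Submission
  imports
    Defs
    "HOL-Algebra.Free_Abelian_Groups"
    "HOL-Algebra.Multiplicative_Group"
    "HOL-Number_Theory.Cong"
begin

text \<open>All three conditions are compared with the condition that every image \<open>n G\<close> is trivial or
  infinite.

  For (b): if \<open>n G\<close> is finite and nontrivial, then the fibres of \<open>x \<mapsto> n x\<close> are a finite partition of
  \<open>G\<close> into Zariski closed sets. Conversely a disconnection yields a finite cover of \<open>G\<close> by proper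
  elementary algebraic sets, that is by cosets of torsion subgroups \<open>G[n]\<close>; by B. H. Neumann's lemma
  some \<open>G[n]\<close> has finite index, so that \<open>n G\<close> is finite, hence trivial, and \<open>G[n] = G\<close>.

  For (a) implies the condition: if \<open>n G\<close> is finite, then \<open>G[n]\<close> is open in every Hausdorff group
  topology, so characters of \<open>n G\<close> give continuous characters of \<open>G\<close>.

  For (c) implies (a): in a bounded group a character is trivial on a neighbourhood of the
  identity, so a group norm all of whose balls generate \<open>G\<close> induces a minimally almost periodic
  topology. Such a norm is obtained in the style of Hartman and Mycielski. The summands are
  distributed over countable blocks in such a way that almost all summands of a block have the
  same order \<open>N\<close> and the other orders divide \<open>N\<close>. The generators of a block become multiples of
  indicator functions of intervals \<open>(0, r)\<close> in the step functions from \<open>(0, 1)\<close> to the integers modulo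
  \<open>N\<close>, with distinct end points \<open>r\<close>, dense for the generators of order \<open>N\<close>. The norm is the measure
  of the support; each generator is a sum of elements of small norm.\<close>

subsection \<open>Coverings by cosets and the Zariski topology\<close>

lemma (in group) finite_coset_cover:
  assumes "finite \<H>" and "\<And>H. H \<in> \<H> \<Longrightarrow> subgroup H G"
    and "\<And>H. H \<in> \<H> \<Longrightarrow> finite (F H) \<and> F H \<subseteq> carrier G"
    and "carrier G \<subseteq> (\<Union>H\<in>\<H>. \<Union>a\<in>F H. H #> a)"
  shows "\<exists>H\<in>\<H>. \<exists>E. finite E \<and> E \<subseteq> carrier G \<and> carrier G \<subseteq> (\<Union>a\<in>E. H #> a)"
  using assms
proof (induction arbitrary: F rule: finite_induct)
  case empty
  then show ?case using one_closed by simp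
next
  case (insert H \<H>)
  have H: "subgroup H G" and FH: "finite (F H)" "F H \<subseteq> carrier G"
    using insert.prems(1,2)[of H] by simp_all
  show ?case
  proof (cases "carrier G \<subseteq> (\<Union>a\<in>F H. H #> a)")
    case True
    with FH show ?thesis by (intro bexI[of _ H] exI[of _ "F H"]) simp_all
  next
    case False
    then obtain g where g: "g \<in> carrier G" "g \<notin> (\<Union>a\<in>F H. H #> a)" by (meson subsetI)
    \<comment> \<open>Right translation by \<open>inv g \<otimes> k\<close> carries
      \<open>H #> g\<close> to \<open>H #> k\<close>, and a cover of the former to one of the
      latter.\<close>
    define F' where "F' L = F L \<union> (\<lambda>(l, k). l \<otimes> (inv g \<otimes> k)) ` (F L \<times> F H)" for L
    have "carrier G \<subseteq> (\<Union>L\<in>\<H>. \<Union>a\<in>F' L. L #> a)"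
    proof
      fix x assume x: "x \<in> carrier G"
      then have "x \<in> (\<Union>H\<in>insert H \<H>. \<Union>a\<in>F H. H #> a)" using insert.prems(3) by (rule rev_subsetD)
      then obtain L a where La: "L \<in> insert H \<H>" "a \<in> F L" "x \<in> L #> a" by (elim UN_E)
      show "x \<in> (\<Union>L\<in>\<H>. \<Union>a\<in>F' L. L #> a)"
      proof (cases "L \<in> \<H>")
        case True
        with La show ?thesis by (auto simp: F'_def)
      next
        case False
        with La have L: "L = H" by simp
        have a: "a \<in> carrier G" using La L FH by auto
        obtain h where h: "h \<in> H" "x = h \<otimes> a" using La L by (auto simp: r_coset_def)
        have hc: "h \<in> carrier G" using h H subgroup.subset by blast
        have hg: "h \<otimes> g \<in> H #> g" using h by (auto simp: r_coset_def)
        have "h \<otimes> g \<in> carrier G" using hc g by simp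
        then have "h \<otimes> g \<in> (\<Union>H\<in>insert H \<H>. \<Union>a\<in>F H. H #> a)"
          using insert.prems(3) by (rule rev_subsetD)
        then obtain L' l where L': "L' \<in> insert H \<H>" "l \<in> F L'" "h \<otimes> g \<in> L' #> l" by (elim UN_E)
        \<comment> \<open>The only coset of \<open>H\<close> containing \<open>h \<otimes> g\<close>
          is \<open>H #> g\<close>, which is not among the chosen ones because \<open>g\<close> was
          missed.\<close>
        have "L' \<noteq> H"
        proof
          assume eq: "L' = H"
          then have "l \<in> carrier G" using L' FH by auto
          have "H #> (h \<otimes> g) = H #> l"
            using repr_independence[OF _ \<open>l \<in> carrier G\<close> H] L'(3) eq by auto
          moreover have "H #> (h \<otimes> g) = H #> g"
            using repr_independence[OF hg g(1) H] by simp
          ultimately have "g \<in> H #> l" using rcos_self[OF g(1) H] by simp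
          with g(2) L'(2) eq show False by auto
        qed
        then have L'H: "L' \<in> \<H>" using L' by simp
        have l: "l \<in> carrier G" using L'(2) insert.prems(2)[OF L'(1)] by (meson subsetD)
        obtain y where y: "y \<in> L'" "h \<otimes> g = y \<otimes> l" using L' by (auto simp: r_coset_def)
        have yc: "y \<in> carrier G" using y(1) subgroup.subset[OF insert.prems(1)[OF L'(1)]] by (meson subsetD)
        have "x = h \<otimes> g \<otimes> (inv g \<otimes> a)"
        proof -
          have "g \<otimes> (inv g \<otimes> a) = a" using g(1) a by (metis inv_closed l_one m_assoc r_inv)
          then have "h \<otimes> (g \<otimes> (inv g \<otimes> a)) = x" using h(2) by simp
          then show ?thesis using hc g(1) a by (simp add: m_assoc)
        qed
        also have "\<dots> = y \<otimes> (l \<otimes> (inv g \<otimes> a))"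
          using y yc l g a by (simp add: m_assoc)
        finally have "x \<in> L' #> (l \<otimes> (inv g \<otimes> a))" using y by (auto simp: r_coset_def)
        moreover have "l \<otimes> (inv g \<otimes> a) \<in> F' L'" using L' La L by (auto simp: F'_def)
        ultimately show ?thesis using L'H by blast
      qed
    qed
    moreover have "finite (F' L) \<and> F' L \<subseteq> carrier G" if "L \<in> \<H>" for L
    proof -
      have "finite (F L)" "F L \<subseteq> carrier G" using insert.prems(2)[of L] that by simp_all
      with FH g show ?thesis unfolding F'_def by (auto simp: subset_iff)
    qed
    ultimately have "\<exists>L\<in>\<H>. \<exists>E. finite E \<and> E \<subseteq> carrier G \<and> carrier G \<subseteq> (\<Union>a\<in>E. L #> a)"
      using insert.prems(1) by (intro insert.IH) simp_all
    then show ?thesis by simp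
  qed
qed

section \<open>Torsion subgroups, elementary algebraic sets and Zariski connectedness\<close>

lemma (in comm_group) subgroup_int_torsion: "subgroup {x \<in> carrier G. x [^] (n::int) = \<one>} G"
  by unfold_locales (auto simp: int_pow_distrib int_pow_inv)

text \<open>Bridges the integer exponents of elementary algebraic sets and the natural exponents of
  \<open>power_images_trivial_or_infinite\<close>: powers with exponents \<open>n\<close> and
  \<open>-n\<close> are mutually inverse, so their images are finite together.\<close>

lemma (in comm_group) finite_int_power_image:
  fixes n :: int
  assumes "finite ((\<lambda>x. x [^] nat \<bar>n\<bar>) ` carrier G) \<Longrightarrow> \<forall>x\<in>carrier G. x [^] nat \<bar>n\<bar> = \<one>"
    and "finite ((\<lambda>x. x [^] n) ` carrier G)"
  shows "\<forall>x\<in>carrier G. x [^] n = \<one>"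
proof -
  have eq: "x [^] nat \<bar>n\<bar> = (if n \<ge> 0 then x [^] n else inv (x [^] n))" if "x \<in> carrier G" for x
    using that int_pow_int[of G x "nat \<bar>n\<bar>"] int_pow_neg[of x n] by auto
  have "(\<lambda>x. x [^] nat \<bar>n\<bar>) ` carrier G \<subseteq> (\<lambda>x. x [^] n) ` carrier G \<union> m_inv G ` (\<lambda>x. x [^] n) ` carrier G"
    using eq by auto
  then have "finite ((\<lambda>x. x [^] nat \<bar>n\<bar>) ` carrier G)"
    by (rule finite_subset) (use assms(2) in auto)
  then have "\<forall>x\<in>carrier G. x [^] nat \<bar>n\<bar> = \<one>" by (rule assms(1))
  then show ?thesis using eq by (metis int_pow_closed inv_eq_1_iff)
qed

definition power_images_trivial_or_infinite :: "('a, 'b) monoid_scheme \<Rightarrow> bool" where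
  "power_images_trivial_or_infinite G \<longleftrightarrow>
     (\<forall>n::nat. finite ((\<lambda>x. x [^]\<^bsub>G\<^esub> n) ` carrier G) \<longrightarrow> (\<forall>x\<in>carrier G. x [^]\<^bsub>G\<^esub> n = \<one>\<^bsub>G\<^esub>))"

text \<open>A nonempty solution set of \<open>n x = a\<close> is a coset of \<open>G[n]\<close>, so
  \<open>finite_coset_cover\<close> yields a member of the cover whose torsion subgroup has finite
  index; the condition on power images makes that member all of \<open>G\<close>.\<close>

lemma (in comm_group) no_proper_elementary_cover:
  assumes "power_images_trivial_or_infinite G"
    and "finite \<E>" "\<And>E. E \<in> \<E> \<Longrightarrow> elementary_algebraic G E" "carrier G \<subseteq> \<Union>\<E>"
  shows "carrier G \<in> \<E>"
proof -
  define tor where "tor n = {x \<in> carrier G. x [^] (n::int) = \<one>}" for n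
  \<comment> \<open>An equation without solutions gives the empty set, which is no coset; it is
    discarded first.\<close>
  let ?\<E> = "\<E> - {{}}"
  have "\<exists>n a. a \<in> carrier G \<and> E = tor n #> a" if "E \<in> ?\<E>" for E
  proof -
    obtain n :: int and b where nb: "b \<in> carrier G" "E = {x \<in> carrier G. x [^] n = b}"
      using assms(3) \<open>E \<in> ?\<E>\<close> unfolding elementary_algebraic_def by (meson DiffD1)
    obtain a where a: "a \<in> E" using \<open>E \<in> ?\<E>\<close> by blast
    have "E = tor n #> a"
    proof
      show "E \<subseteq> tor n #> a"
      proof
        fix x assume x: "x \<in> E"
        have "x = (x \<otimes> inv a) \<otimes> a" using a x nb by (simp add: m_assoc)
        moreover have "x \<otimes> inv a \<in> tor n"
          using a x nb by (simp add: tor_def int_pow_distrib int_pow_inv)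
        ultimately show "x \<in> tor n #> a" unfolding r_coset_def by blast
      qed
      show "tor n #> a \<subseteq> E"
        using a nb by (auto simp: r_coset_def tor_def int_pow_distrib)
    qed
    with a nb show ?thesis by blast
  qed
  then obtain n a where na: "\<And>E. E \<in> ?\<E> \<Longrightarrow> a E \<in> carrier G \<and> E = tor (n E) #> a E"
    by metis
  have "\<exists>H\<in>(tor \<circ> n) ` ?\<E>. \<exists>F. finite F \<and> F \<subseteq> carrier G \<and> carrier G \<subseteq> (\<Union>b\<in>F. H #> b)"
  proof (rule finite_coset_cover[where F = "\<lambda>_. a ` ?\<E>"])
    show "finite ((tor \<circ> n) ` ?\<E>)" using assms(2) by simp
    show "subgroup H G" if "H \<in> (tor \<circ> n) ` ?\<E>" for H
      using that subgroup_int_torsion by (auto simp: tor_def)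
    show "finite (a ` ?\<E>) \<and> a ` ?\<E> \<subseteq> carrier G" for H :: "'a set"
      using na assms(2) by blast
    show "carrier G \<subseteq> (\<Union>H\<in>(tor \<circ> n) ` ?\<E>. \<Union>b\<in>a ` ?\<E>. H #> b)"
    proof
      fix x assume "x \<in> carrier G"
      then obtain E where "E \<in> ?\<E>" "x \<in> E" using assms(4) by blast
      with na[of E] show "x \<in> (\<Union>H\<in>(tor \<circ> n) ` ?\<E>. \<Union>b\<in>a ` ?\<E>. H #> b)" by auto
    qed
  qed
  then obtain E F where E: "E \<in> ?\<E>" and F: "finite F" "F \<subseteq> carrier G"
      "carrier G \<subseteq> (\<Union>b\<in>F. tor (n E) #> b)"
    by auto
  \<comment> \<open>Exponentiation by \<open>n E\<close> is constant on cosets of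
    \<open>tor (n E)\<close>, so finitely many cosets give finitely many powers.\<close>
  have "(\<lambda>x. x [^] n E) ` carrier G \<subseteq> (\<lambda>x. x [^] n E) ` F"
  proof (rule image_subsetI)
    fix x assume "x \<in> carrier G"
    then obtain b t where "b \<in> F" "t \<in> tor (n E)" "x = t \<otimes> b"
      using F(3) by (fastforce simp: r_coset_def)
    with F(2) show "x [^] n E \<in> (\<lambda>x. x [^] n E) ` F"
      by (auto simp: tor_def int_pow_distrib subset_iff)
  qed
  with F(1) have fin: "finite ((\<lambda>x. x [^] n E) ` carrier G)" using finite_subset by blast
  have "\<forall>x\<in>carrier G. x [^] n E = \<one>"
    by (rule finite_int_power_image[OF _ fin])
      (use assms(1) in \<open>unfold power_images_trivial_or_infinite_def, blast\<close>)
  then have "tor (n E) = carrier G" by (auto simp: tor_def)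
  then have "E = carrier G" using na[OF E] coset_join2 subgroup_self by metis
  with E show ?thesis by blast
qed

lemma (in comm_group) zariski_connected_iff:
  "zariski_connected G \<longleftrightarrow> power_images_trivial_or_infinite G"
proof
  assume conn: "zariski_connected G"
  show "power_images_trivial_or_infinite G"
    unfolding power_images_trivial_or_infinite_def
  proof (intro allI impI)
    fix n :: nat assume fin: "finite ((\<lambda>x. x [^] n) ` carrier G)"
    let ?E = "\<lambda>a. {x \<in> carrier G. x [^] int n = a}"
    have alg: "algebraic_set G (\<Union>(?E ` A))" if "finite A" "A \<subseteq> carrier G" for A
      unfolding algebraic_set_def
      using that by (intro exI[of _ "{?E ` A}"]) (auto simp: elementary_algebraic_def)
    \<comment> \<open>The nontrivial \<open>n\<close>-th powers. The fibres over
      \<open>\<one>\<close> and over \<open>?B\<close> form complementary closed sets, and the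
      former contains \<open>\<one>\<close>, so connectedness empties the latter.\<close>
    let ?B = "(\<lambda>x. x [^] n) ` carrier G - {\<one>}"
    have "closedin (zariski_topology G) (\<Union>(?E ` {\<one>}))"
      "closedin (zariski_topology G) (\<Union>(?E ` ?B))"
      unfolding closedin_zariski_topology using alg[of "{\<one>}"] alg[of ?B] fin by blast+
    moreover have "\<Union>(?E ` {\<one>}) \<union> \<Union>(?E ` ?B) = topspace (zariski_topology G)"
      unfolding topspace_zariski_topology by (auto simp: int_pow_int)
    moreover have "\<Union>(?E ` {\<one>}) \<inter> \<Union>(?E ` ?B) = {}" by auto
    moreover have "\<Union>(?E ` {\<one>}) \<noteq> {}" by auto
    ultimately have "\<Union>(?E ` ?B) = {}"
      using conn unfolding zariski_connected_def connected_space_closedin_eq by meson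
    then have B: "\<And>x. x \<in> carrier G \<Longrightarrow> x [^] n \<in> ?B \<Longrightarrow> False" by (auto simp: int_pow_int)
    show "\<forall>x\<in>carrier G. x [^] n = \<one>" using B by blast
  qed
next
  assume d: "power_images_trivial_or_infinite G"
  show "zariski_connected G"
    unfolding zariski_connected_def connected_space_closedin_eq
  proof (intro notI, elim exE conjE)
    fix C D
    assume CD: "closedin (zariski_topology G) C" "closedin (zariski_topology G) D"
      "C \<union> D = topspace (zariski_topology G)" "C \<inter> D = {}" "C \<noteq> {}" "D \<noteq> {}"
    then have alg: "algebraic_set G C" "algebraic_set G D" and un: "C \<union> D = carrier G"
      by (simp_all add: closedin_zariski_topology topspace_zariski_topology)
    obtain x y where "x \<in> D" "y \<in> C" using CD by blast
    then have xy: "x \<in> carrier G - C" "y \<in> carrier G - D" using CD un by blast+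
    obtain \<E>1 where E1: "finite \<E>1" "\<forall>E\<in>\<E>1. elementary_algebraic G E" "C \<subseteq> \<Union>\<E>1" "x \<notin> \<Union>\<E>1"
      using alg(1) xy(1) unfolding algebraic_set_iff by blast
    obtain \<E>2 where E2: "finite \<E>2" "\<forall>E\<in>\<E>2. elementary_algebraic G E" "D \<subseteq> \<Union>\<E>2" "y \<notin> \<Union>\<E>2"
      using alg(2) xy(2) unfolding algebraic_set_iff by blast
    \<comment> \<open>A cover member equal to \<open>G\<close> would contain both \<open>x\<close>
      and \<open>y\<close>, but the first family avoids \<open>x\<close> and the second avoids
      \<open>y\<close>.\<close>
    have "carrier G \<in> \<E>1 \<union> \<E>2"
      by (rule no_proper_elementary_cover[OF d]) (use E1 E2 un in auto)
    then show False using xy E1(4) E2(4) by blast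
  qed
qed

subsection \<open>Bases of the layers of the socle\<close>

text \<open>For elements killed by \<open>p\<close> this is linear independence over the field with
  \<open>p\<close> elements, with integers representing the scalars.\<close>

definition p_independent :: "('a, 'b) monoid_scheme \<Rightarrow> nat \<Rightarrow> 'a set \<Rightarrow> bool" where
  "p_independent G p B \<longleftrightarrow>
     (\<forall>F c. finite F \<and> F \<subseteq> B \<and> finprod G (\<lambda>b. b [^]\<^bsub>G\<^esub> (c b::int)) F = \<one>\<^bsub>G\<^esub> \<longrightarrow> (\<forall>b\<in>F. int p dvd c b))"

lemma (in comm_group) finprod_in_subgroup:
  assumes "subgroup H G" "\<And>i. i \<in> F \<Longrightarrow> f i \<in> H"
  shows "finprod G f F \<in> H"
  using assms(2)
proof (induction F rule: infinite_finite_induct)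
  case (insert i F)
  have "f \<in> insert i F \<rightarrow> carrier G" using insert.prems subgroup.subset[OF assms(1)] by auto
  then have "finprod G f (insert i F) = f i \<otimes> finprod G f F"
    using insert.hyps by (intro finprod_insert) auto
  then show ?case using insert subgroup.m_closed[OF assms(1)] by simp
qed (simp_all add: subgroup.one_closed[OF assms(1)])

text \<open>Were the coefficient of \<open>s\<close> prime to \<open>p\<close>, Bezout would recover
  \<open>s\<close> from a power of it that lies in \<open>generate G B\<close>. So the coefficient
  is a multiple of \<open>p\<close>, the factor of \<open>s\<close> vanishes, and independence of
  \<open>B\<close> applies.\<close>

lemma (in comm_group) p_independent_insert:
  assumes p: "Factorial_Ring.prime p" and B: "p_independent G p B" "B \<subseteq> carrier G"
    and s: "s \<in> carrier G" "s [^] p = \<one>" "s \<notin> generate G B"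
  shows "p_independent G p (insert s B)"
  unfolding p_independent_def
proof (intro allI impI, elim conjE)
  fix F and c :: "'a \<Rightarrow> int"
  assume F: "finite F" "F \<subseteq> insert s B" and eq: "finprod G (\<lambda>b. b [^] c b) F = \<one>"
  show "\<forall>b\<in>F. int p dvd c b"
  proof (cases "s \<in> F")
    case False
    then show ?thesis using B(1) F eq unfolding p_independent_def by blast
  next
    case True
    define F' where "F' = F - {s}"
    have F': "finite F'" "F' \<subseteq> B" "s \<notin> F'" "F = insert s F'" using F True by (auto simp: F'_def)
    have gB: "subgroup (generate G B) G" by (rule generate_is_subgroup[OF B(2)])
    have f: "(\<lambda>b. b [^] c b) \<in> F' \<rightarrow> carrier G" using F'(2) B(2) by auto
    have split: "s [^] c s \<otimes> finprod G (\<lambda>b. b [^] c b) F' = \<one>"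
      using eq F' f s(1) by simp
    have mem: "finprod G (\<lambda>b. b [^] c b) F' \<in> generate G B"
    proof (rule finprod_in_subgroup[OF gB])
      fix b assume "b \<in> F'"
      then have "b \<in> generate G B" using F'(2) by (auto intro: generate.incl)
      then show "b [^] c b \<in> generate G B" by (rule subgroup_int_pow_closed[OF gB])
    qed
    have "s [^] c s = inv (finprod G (\<lambda>b. b [^] c b) F')"
      using split s(1) f by (metis finprod_closed int_pow_closed inv_equality)
    then have spow: "s [^] c s \<in> generate G B"
      using mem subgroup.m_inv_closed[OF gB] by simp
    have dvd: "int p dvd c s"
    proof (rule ccontr)
      assume "\<not> int p dvd c s"
      then have "coprime (int p) (c s)" using p by (simp add: prime_imp_coprime)
      then obtain u v where uv: "u * int p + v * c s = 1"
        by (metis bezout_int coprime_iff_gcd_eq_1)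
      have "s = s [^] (u * int p + v * c s)" using s(1) uv by simp
      also have "\<dots> = (s [^] int p) [^] u \<otimes> (s [^] c s) [^] v"
        using s(1) by (simp add: int_pow_mult int_pow_pow mult.commute)
      also have "\<dots> = (s [^] c s) [^] v" using s(1,2) by (simp add: int_pow_int)
      also have "\<dots> \<in> generate G B" by (rule subgroup_int_pow_closed[OF gB spow])
      finally show False using s(3) by simp
    qed
    then obtain k where k: "c s = int p * k" by (elim dvdE)
    have "s [^] c s = (s [^] int p) [^] k" unfolding k using s(1) by (simp add: int_pow_pow)
    also have "\<dots> = \<one>" using s(2) by (simp add: int_pow_int)
    finally have "finprod G (\<lambda>b. b [^] c b) F' = \<one>" using split f by simp
    then have "\<forall>b\<in>F'. int p dvd c b" using B(1) F'(1,2) unfolding p_independent_def by blast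
    with dvd F'(4) show ?thesis by simp
  qed
qed

text \<open>Zorn's lemma: a relation involves finitely many elements, hence lives in one member of a
  chain, and a maximal independent set generates by \<open>p_independent_insert\<close>.\<close>

lemma (in comm_group) p_independent_extend:
  assumes p: "Factorial_Ring.prime p" and S: "subgroup S G" "\<And>x. x \<in> S \<Longrightarrow> x [^] p = \<one>"
    and B: "B \<subseteq> S" "p_independent G p B"
  shows "\<exists>D. B \<subseteq> D \<and> D \<subseteq> S \<and> p_independent G p D \<and> S \<subseteq> generate G D"
proof -
  let ?A = "{D. B \<subseteq> D \<and> D \<subseteq> S \<and> p_independent G p D}"
  have "\<exists>M\<in>?A. \<forall>X\<in>?A. M \<subseteq> X \<longrightarrow> X = M"
  proof (rule subset_Zorn_nonempty)
    have "B \<in> ?A" using B by simp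
    then show "?A \<noteq> {}" by blast
  next
    fix \<C> assume C: "\<C> \<noteq> {}" "subset.chain ?A \<C>"
    then have sub: "\<C> \<subseteq> ?A" by (simp add: subset_chain_def)
    have "p_independent G p (\<Union>\<C>)"
      unfolding p_independent_def
    proof (intro allI impI, elim conjE)
      fix F and c :: "'a \<Rightarrow> int"
      assume F: "finite F" "F \<subseteq> \<Union>\<C>" and eq: "finprod G (\<lambda>b. b [^] c b) F = \<one>"
      obtain X where "X \<in> \<C>" "F \<subseteq> X" using finite_subset_Union_chain[OF F C] by blast
      then have "p_independent G p X" using sub by auto
      with \<open>F \<subseteq> X\<close> F(1) eq show "\<forall>b\<in>F. int p dvd c b" unfolding p_independent_def by blast
    qed
    moreover have "B \<subseteq> \<Union>\<C>" "\<Union>\<C> \<subseteq> S" using sub C(1) by auto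
    ultimately show "\<Union>\<C> \<in> ?A" by simp
  qed
  then obtain M where M: "B \<subseteq> M" "M \<subseteq> S" "p_independent G p M"
    and max: "\<And>X. X \<in> ?A \<Longrightarrow> M \<subseteq> X \<Longrightarrow> X = M" by auto
  have Sc: "S \<subseteq> carrier G" by (rule subgroup.subset[OF S(1)])
  have "S \<subseteq> generate G M"
  proof
    fix s assume s: "s \<in> S"
    show "s \<in> generate G M"
    proof (rule ccontr)
      assume ns: "s \<notin> generate G M"
      then have "p_independent G p (insert s M)"
        using M(2) Sc s by (intro p_independent_insert[OF p M(3) _ _ S(2)[OF s] ns]) auto
      then have "insert s M = M" using M(1,2) s by (intro max) auto
      then have "s \<in> generate G M" by (auto intro: generate.incl)
      with ns show False by contradiction
    qed
  qed
  with M show ?thesis by (intro exI[of _ M]) simp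
qed

text \<open>This is \<open>G[p] \<inter> p^j G\<close>, the filtration of the socle whose successive
  quotients are measured by the Ulm-Kaplansky invariants.\<close>

definition socle_layer :: "('a, 'b) monoid_scheme \<Rightarrow> nat \<Rightarrow> nat \<Rightarrow> 'a set" where
  "socle_layer G p j =
     {x \<in> carrier G. x [^]\<^bsub>G\<^esub> p = \<one>\<^bsub>G\<^esub> \<and> (\<exists>z\<in>carrier G. x = z [^]\<^bsub>G\<^esub> (p ^ j))}"

lemma (in comm_group) subgroup_socle_layer: "subgroup (socle_layer G p j) G"
proof
  show "socle_layer G p j \<subseteq> carrier G" by (auto simp: socle_layer_def)
  show "\<one> \<in> socle_layer G p j" by (auto simp: socle_layer_def intro!: bexI[of _ \<one>])
  fix x assume "x \<in> socle_layer G p j"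
  then obtain z where z: "z \<in> carrier G" "x = z [^] (p ^ j)" "x [^] p = \<one>" by (auto simp: socle_layer_def)
  have "inv x = inv z [^] (p ^ j)" "inv x [^] p = \<one>" using z by (simp_all add: nat_pow_inv)
  then show "inv x \<in> socle_layer G p j" using z by (auto simp: socle_layer_def)
  fix y assume "y \<in> socle_layer G p j"
  then obtain w where w: "w \<in> carrier G" "y = w [^] (p ^ j)" "y [^] p = \<one>" by (auto simp: socle_layer_def)
  have "x \<otimes> y = (z \<otimes> w) [^] (p ^ j)" using z w by (simp add: nat_pow_distrib)
  moreover have "(x \<otimes> y) [^] p = \<one>" using z w by (simp add: nat_pow_distrib)
  ultimately show "x \<otimes> y \<in> socle_layer G p j" using z w by (auto simp: socle_layer_def)
qed

lemma (in comm_group) socle_layer_antimono: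
  assumes "i \<le> j"
  shows "socle_layer G p j \<subseteq> socle_layer G p i"
proof
  fix x assume "x \<in> socle_layer G p j"
  then obtain z where z: "z \<in> carrier G" "x = z [^] (p ^ j)" "x [^] p = \<one>" by (auto simp: socle_layer_def)
  have "x = (z [^] (p ^ (j - i))) [^] (p ^ i)"
    using z(1,2) assms by (simp add: nat_pow_pow flip: power_add)
  then show "x \<in> socle_layer G p i" using z by (auto simp: socle_layer_def)
qed

text \<open>\<open>N\<close> is a crude bound for heights: the order of a root \<open>z\<close> is a
  power \<open>p ^ k\<close> dividing \<open>N\<close>, so \<open>k < p ^ k \<le> N \<le> j\<close>
  and already \<open>p ^ j\<close> kills \<open>z\<close>.\<close>

lemma (in comm_group) socle_layer_trivial:
  assumes p: "Factorial_Ring.prime p" and N: "N \<ge> 1" "\<And>x. x \<in> carrier G \<Longrightarrow> x [^] N = \<one>" and "N \<le> j"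
  shows "socle_layer G p j = {\<one>}"
proof
  show "{\<one>} \<subseteq> socle_layer G p j" using subgroup.one_closed[OF subgroup_socle_layer] by blast
  show "socle_layer G p j \<subseteq> {\<one>}"
  proof
    fix x assume "x \<in> socle_layer G p j"
    then obtain z where z: "z \<in> carrier G" "x = z [^] (p ^ j)" "x [^] p = \<one>" by (auto simp: socle_layer_def)
    have "z [^] (p ^ Suc j) = \<one>" using z by (simp add: nat_pow_pow mult.commute)
    then have "ord z dvd p ^ Suc j" using z(1) pow_eq_id by blast
    then obtain k where k: "ord z = p ^ k" using p divides_primepow_nat by blast
    have "ord z dvd N" using z(1) N(2) pow_eq_id by blast
    then have "p ^ k \<le> N" using N(1) k by (auto dest: dvd_imp_le)
    moreover have "k < p ^ k" using prime_gt_1_nat[OF p] by (simp add: power_gt_expt)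
    ultimately have "k \<le> j" using assms(4) by linarith
    then have "ord z dvd p ^ j" using k by (simp add: le_imp_power_dvd)
    then have "x = \<one>" using z pow_eq_id by blast
    then show "x \<in> {\<one>}" by simp
  qed
qed

text \<open>Nested bases adapted to the whole filtration. They are built from the trivial layer
  \<open>N\<close> downwards, because a basis of a smaller layer extends to a larger one, while a
  basis of the larger layer need not contain one of the smaller.\<close>

lemma (in comm_group) socle_basis_chain:
  assumes p: "Factorial_Ring.prime p" and N: "N \<ge> 1" "\<And>x. x \<in> carrier G \<Longrightarrow> x [^] N = \<one>"
  shows "\<exists>D :: nat \<Rightarrow> 'a set. (\<forall>j. D j \<subseteq> socle_layer G p j \<and> p_independent G p (D j) \<and>
            socle_layer G p j \<subseteq> generate G (D j) \<and> D (Suc j) \<subseteq> D j) \<and> D N = {}"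
proof -
  let ?V = "socle_layer G p"
  \<comment> \<open>Step \<open>n\<close> treats layer \<open>N - n\<close>; truncated subtraction
    makes it stay at layer \<open>0\<close> from \<open>n = N\<close> on.\<close>
  let ?P = "\<lambda>n B. B \<subseteq> ?V (N - n) \<and> p_independent G p B \<and> ?V (N - n) \<subseteq> generate G B \<and> (n = 0 \<longrightarrow> B = {})"
  have triv: "?V j \<subseteq> generate G {}" if "N \<le> j" for j
    using socle_layer_trivial[OF p N that] by (auto intro: generate.one)
  have "\<exists>E. \<forall>n. ?P n (E n) \<and> E n \<subseteq> E (Suc n)"
  proof (rule dependent_nat_choice)
    show "\<exists>B. ?P 0 B" using triv[of N] by (intro exI[of _ "{}"]) (simp add: p_independent_def)
    fix B n assume B: "?P n B"
    have "?V (N - n) \<subseteq> ?V (N - Suc n)" by (rule socle_layer_antimono) simp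
    with B have "B \<subseteq> ?V (N - Suc n)" by (meson order_trans)
    then have "\<exists>D. B \<subseteq> D \<and> D \<subseteq> ?V (N - Suc n) \<and> p_independent G p D \<and> ?V (N - Suc n) \<subseteq> generate G D"
      using B by (intro p_independent_extend[OF p subgroup_socle_layer]) (simp_all add: socle_layer_def)
    then show "\<exists>D. ?P (Suc n) D \<and> B \<subseteq> D" by auto
  qed
  then obtain E where "\<forall>n. ?P n (E n) \<and> E n \<subseteq> E (Suc n)" by (elim exE)
  then have E: "?P n (E n)" "E n \<subseteq> E (Suc n)" for n by simp_all
  define D where "D j = E (N - j)" for j
  have "D j \<subseteq> ?V j \<and> p_independent G p (D j) \<and> ?V j \<subseteq> generate G (D j) \<and> D (Suc j) \<subseteq> D j" for j
  proof (cases "j < N")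
    case True
    then have "N - j = Suc (N - Suc j)" "N - (N - j) = j" by auto
    then show ?thesis unfolding D_def using E(1)[of "N - j"] E(2)[of "N - Suc j"] by simp
  next
    case False
    then show ?thesis unfolding D_def using E(1)[of 0] triv[of j] by auto
  qed
  moreover have "D N = {}" using E(1)[of 0] by (simp add: D_def)
  ultimately show ?thesis by blast
qed

subsection \<open>Direct sums of cyclic groups\<close>

definition zmod_sum :: "'i set \<Rightarrow> ('i \<Rightarrow> nat) \<Rightarrow> ('i \<Rightarrow> int) monoid" where
  "zmod_sum I n = sum_group I (\<lambda>i. integer_mod_group (n i))"

lemma cyclic_sum_eq_zmod_sum:
  "cyclic_sum P m A = zmod_sum (SIGMA p:P. SIGMA i:{1..m p}. A p i) (\<lambda>(p, i, _). p ^ i)"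
  unfolding cyclic_sum_def zmod_sum_def
  by (intro arg_cong2[where f = sum_group] refl ext) (simp split: prod.split)

lemma one_zmod_sum: "\<one>\<^bsub>zmod_sum I n\<^esub> = (\<lambda>i\<in>I. 0)"
  by (simp add: zmod_sum_def)

lemma mult_zmod_sum: "f \<otimes>\<^bsub>zmod_sum I n\<^esub> g = (\<lambda>i\<in>I. (f i + g i) mod int (n i))"
  by (simp add: zmod_sum_def)

text \<open>Positive moduli matter: \<open>integer_mod_group 0\<close> is the group of all
  integers.\<close>

lemma carrier_zmod_sum:
  assumes "\<forall>i\<in>I. n i > 0"
  shows "f \<in> carrier (zmod_sum I n) \<longleftrightarrow>
    f \<in> extensional I \<and> (\<forall>i\<in>I. 0 \<le> f i \<and> f i < int (n i)) \<and> finite {i \<in> I. f i \<noteq> 0}"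
proof -
  have "carrier (integer_mod_group (n i)) = {0..<int (n i)}" if "i \<in> I" for i
    using assms that by (simp add: carrier_integer_mod_group)
  then have "(\<Pi>\<^sub>E i\<in>I. carrier (integer_mod_group (n i))) = (\<Pi>\<^sub>E i\<in>I. {0..<int (n i)})"
    by (rule PiE_cong)
  then show ?thesis
    by (auto simp: zmod_sum_def carrier_sum_group PiE_def Pi_def)
qed

lemma comm_group_zmod_sum: "comm_group (zmod_sum I n)"
proof -
  interpret group "zmod_sum I n" by (simp add: zmod_sum_def)
  show ?thesis by (rule group_comm_groupI) (simp add: mult_zmod_sum add.commute)
qed

lemma pow_zmod_sum:
  assumes "f \<in> carrier (zmod_sum I n)" "\<forall>i\<in>I. n i > 0"
  shows "f [^]\<^bsub>zmod_sum I n\<^esub> (k::nat) = (\<lambda>i\<in>I. (int k * f i) mod int (n i))"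
proof (induction k)
  case 0
  then show ?case by (simp add: one_zmod_sum)
next
  case (Suc k)
  interpret comm_group "zmod_sum I n" by (rule comm_group_zmod_sum)
  have "f [^]\<^bsub>zmod_sum I n\<^esub> Suc k = f [^]\<^bsub>zmod_sum I n\<^esub> k \<otimes>\<^bsub>zmod_sum I n\<^esub> f" by simp
  also have "\<dots> = (\<lambda>i\<in>I. (int (Suc k) * f i) mod int (n i))"
    unfolding Suc mult_zmod_sum by (rule restrict_ext) (simp add: mod_simps algebra_simps)
  finally show ?case .
qed

definition unit_vec :: "'i set \<Rightarrow> 'i \<Rightarrow> 'i \<Rightarrow> int" where
  "unit_vec I i = (\<lambda>j\<in>I. if j = i then 1 else 0)"

lemma unit_vec_closed:
  assumes "\<forall>i\<in>I. n i > 1" "i \<in> I"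
  shows "unit_vec I i \<in> carrier (zmod_sum I n)"
proof -
  have "\<forall>i\<in>I. n i > 0" using assms(1) by fastforce
  moreover have "{j \<in> I. unit_vec I i j \<noteq> 0} \<subseteq> {i}" by (auto simp: unit_vec_def)
  then have "finite {j \<in> I. unit_vec I i j \<noteq> 0}" by (rule finite_subset) simp
  ultimately show ?thesis using assms(1) by (subst carrier_zmod_sum) (force simp: unit_vec_def)+
qed

text \<open>Unit vectors generate the direct sum: induction over a finite set containing the support
  clears one coordinate at a time by a power of a unit vector.\<close>

lemma subgroup_zmod_sum_eqI:
  assumes n: "\<forall>i\<in>I. n i > 1" and H: "subgroup H (zmod_sum I n)"
    and unit: "\<And>i. i \<in> I \<Longrightarrow> unit_vec I i \<in> H"
  shows "H = carrier (zmod_sum I n)"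
proof
  show "H \<subseteq> carrier (zmod_sum I n)" by (rule subgroup.subset[OF H])
  interpret comm_group "zmod_sum I n" by (rule comm_group_zmod_sum)
  have n0: "\<forall>i\<in>I. n i > 0" using n by fastforce
  note carr = carrier_zmod_sum[OF n0]
  have "f \<in> carrier (zmod_sum I n) \<Longrightarrow> {i \<in> I. f i \<noteq> 0} \<subseteq> S \<Longrightarrow> f \<in> H" if "finite S" for S f
    using that
  proof (induction S arbitrary: f)
    case empty
    then have "f \<in> extensional I" "\<And>i. i \<in> I \<Longrightarrow> f i = 0" using carr[of f] by auto
    then have "f = \<one>\<^bsub>zmod_sum I n\<^esub>" unfolding one_zmod_sum by (auto simp: extensional_def)
    then show ?case using subgroup.one_closed[OF H] by simp
  next
    case (insert i S)
    show ?case
    proof (cases "i \<in> I")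
      case False
      then have "{j \<in> I. f j \<noteq> 0} \<subseteq> S" using insert.prems(2) by auto
      then show ?thesis by (rule insert.IH[OF insert.prems(1)])
    next
      case True
      define g where "g = f(i := 0)"
      have f: "f \<in> extensional I" "\<And>j. j \<in> I \<Longrightarrow> 0 \<le> f j \<and> f j < int (n j)" "finite {i \<in> I. f i \<noteq> 0}"
        using insert.prems(1) by (auto simp: carr)
      have "{j \<in> I. g j \<noteq> 0} \<subseteq> {j \<in> I. f j \<noteq> 0}" by (auto simp: g_def)
      then have "finite {j \<in> I. g j \<noteq> 0}" using f(3) finite_subset by blast
      then have g: "g \<in> carrier (zmod_sum I n)"
        using f n0 True by (auto simp: carr g_def extensional_def)
      have "{j \<in> I. g j \<noteq> 0} \<subseteq> S" using insert.prems(2) by (auto simp: g_def)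
      then have gH: "g \<in> H" using g by (intro insert.IH)
      let ?u = "unit_vec I i [^]\<^bsub>zmod_sum I n\<^esub> nat (f i)"
      have uH: "?u \<in> H" using unit[OF True] H by (metis int_pow_int subgroup_int_pow_closed)
      have u: "?u = (\<lambda>j\<in>I. (int (nat (f i)) * unit_vec I i j) mod int (n j))"
        by (rule pow_zmod_sum[OF unit_vec_closed[OF n True] n0])
      have "f = g \<otimes>\<^bsub>zmod_sum I n\<^esub> ?u"
        unfolding mult_zmod_sum u
      proof
        fix j
        have "f j mod int (n j) = f j" if "j \<in> I" using f(2)[OF that] by simp
        then show "f j = (\<lambda>k\<in>I. (g k + (\<lambda>k\<in>I. (int (nat (f i)) * unit_vec I i k) mod int (n k)) k) mod int (n k)) j"
          using f(1) f(2)[OF True] by (simp add: g_def unit_vec_def extensional_def)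
      qed
      then show ?thesis using subgroup.m_closed[OF H gH uH] by simp
    qed
  qed
  note mem = this
  show "carrier (zmod_sum I n) \<subseteq> H"
  proof
    fix f assume f: "f \<in> carrier (zmod_sum I n)"
    then have "finite {i \<in> I. f i \<noteq> 0}" using carr[of f] by simp
    then show "f \<in> H" by (rule mem[OF _ f order_refl])
  qed
qed

section \<open>Homomorphisms out of direct sums of cyclic groups\<close>

lemma (in comm_group) int_pow_mod:
  assumes "x \<in> carrier G" "x [^] (n::nat) = \<one>"
  shows "x [^] (k mod int n) = x [^] k"
proof -
  have "x [^] k = x [^] (k mod int n + int n * (k div int n))" by (simp add: mult.commute)
  also have "\<dots> = x [^] (k mod int n) \<otimes> (x [^] int n) [^] (k div int n)"
    using assms(1) by (simp only: int_pow_mult int_pow_pow)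
  also have "\<dots> = x [^] (k mod int n)" using assms by (simp add: int_pow_int)
  finally show ?thesis by simp
qed

text \<open>\<open>gfinprod\<close> multiplies the factors different from the identity, so a
  finitely supported \<open>f\<close> has a meaningful value even for infinite
  \<open>I\<close>.\<close>

definition combination :: "('a, 'b) monoid_scheme \<Rightarrow> 'i set \<Rightarrow> ('i \<Rightarrow> 'a) \<Rightarrow> ('i \<Rightarrow> int) \<Rightarrow> 'a" where
  "combination G I y f = gfinprod G (\<lambda>i. y i [^]\<^bsub>G\<^esub> f i) I"

text \<open>The universal property of the direct sum; since \<open>n i\<close> kills
  \<open>y i\<close>, exponents of \<open>y i\<close> may be read modulo \<open>n i\<close>.\<close>

lemma (in comm_group) combination_hom:
  assumes "\<forall>i\<in>I. y i \<in> carrier G" "\<forall>i\<in>I. y i [^] n i = \<one>"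
  shows "combination G I y \<in> hom (zmod_sum I n) G"
  unfolding combination_def zmod_sum_def
proof (rule hom_group_sum)
  fix i assume i: "i \<in> I"
  show "(\<lambda>k. y i [^] k) \<in> hom (integer_mod_group (n i)) G"
    using assms i by (auto intro!: homI simp: int_pow_mod int_pow_mult)
qed simp

lemma (in comm_group) combination_eq_finprod:
  assumes "\<forall>i\<in>I. y i \<in> carrier G" "finite F" "F \<subseteq> I" "\<And>i. i \<in> I - F \<Longrightarrow> f i = 0"
  shows "combination G I y f = finprod G (\<lambda>i. y i [^] f i) F"
proof -
  have sub: "{i \<in> I. y i [^] f i \<noteq> \<one>} \<subseteq> F" using assms(4) by force
  then have fin: "finite {i \<in> I. y i [^] f i \<noteq> \<one>}" using assms(2) finite_subset by blast
  have "finprod G (\<lambda>i. y i [^] f i) {i \<in> I. y i [^] f i \<noteq> \<one>} = finprod G (\<lambda>i. y i [^] f i) F"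
    using assms(1,2,3) sub by (intro finprod_mono_neutral_cong_left) auto
  then show ?thesis using fin by (simp add: combination_def gfinprod_def)
qed

lemma (in comm_group) combination_unit_vec:
  assumes "\<forall>i\<in>I. y i \<in> carrier G" "i \<in> I"
  shows "combination G I y (unit_vec I i) = y i"
proof -
  have "combination G I y (unit_vec I i) = finprod G (\<lambda>j. y j [^] unit_vec I i j) {i}"
    using assms by (intro combination_eq_finprod) (auto simp: unit_vec_def)
  then show ?thesis using assms by (simp add: unit_vec_def)
qed

subsection \<open>Bounded abelian groups are direct sums of cyclic groups\<close>

locale cyclic_basis = comm_group G for G (structure) +
  fixes N :: nat and D :: "nat \<Rightarrow> nat \<Rightarrow> 'a set"
  assumes N: "N \<ge> 1" "x \<in> carrier G \<Longrightarrow> x [^] N = \<one>"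
    and D: "Factorial_Ring.prime p \<Longrightarrow> D p j \<subseteq> socle_layer G p j"
      "Factorial_Ring.prime p \<Longrightarrow> p_independent G p (D p j)"
      "Factorial_Ring.prime p \<Longrightarrow> socle_layer G p j \<subseteq> generate G (D p j)"
      "Factorial_Ring.prime p \<Longrightarrow> D p (Suc j) \<subseteq> D p j"
      "Factorial_Ring.prime p \<Longrightarrow> D p N = {}"
begin

text \<open>The basis elements in \<open>level p i\<close> lie in \<open>p ^ (i - 1) G\<close> and are
  independent of \<open>p ^ i G\<close>; each serves as index of a cyclic summand of order \<open>p ^ i\<close>, generated
  by a root \<open>gen\<close> of it.\<close>

definition "primes_occurring = {p. Factorial_Ring.prime p \<and> D p 0 \<noteq> {}}"
definition "height p = (LEAST i. D p i = {})"
definition "level p i = D p (i - 1) - D p i"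
definition "index = (SIGMA p:primes_occurring. SIGMA i:{1..height p}. level p i)"
definition "ord_of = (\<lambda>(p, i, _::'a). p ^ i :: nat)"
definition "gen = (\<lambda>(p, i, x). SOME z. z \<in> carrier G \<and> x = z [^] (p ^ (i - 1) :: nat))"

lemma D_antimono: "Factorial_Ring.prime p \<Longrightarrow> i \<le> j \<Longrightarrow> D p j \<subseteq> D p i"
  by (rule lift_Suc_antimono_le[of "D p"]) (auto dest: D(4))

lemma D_height: "Factorial_Ring.prime p \<Longrightarrow> D p (height p) = {}"
  unfolding height_def by (rule LeastI[of _ N]) (rule D(5))

lemma indexE:
  assumes "t \<in> index"
  obtains p i x where "t = (p, i, x)" "Factorial_Ring.prime p" "1 \<le> i" "i \<le> height p"
    "x \<in> D p (i - 1)" "x \<notin> D p i" "x \<in> D p 0" "x \<in> socle_layer G p (i - 1)"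
proof -
  obtain p i x where t: "t = (p, i, x)" "Factorial_Ring.prime p" "1 \<le> i" "i \<le> height p"
    "x \<in> D p (i - 1)" "x \<notin> D p i"
    using assms by (auto simp: index_def primes_occurring_def level_def)
  moreover have "x \<in> D p 0" using D_antimono[OF t(2), of 0 "i - 1"] t(5) by auto
  moreover have "x \<in> socle_layer G p (i - 1)" using D(1)[OF t(2)] t(5) by auto
  ultimately show thesis by (rule that)
qed

lemma ord_of_gt_1: "\<forall>t\<in>index. ord_of t > 1"
proof
  fix t assume "t \<in> index"
  then obtain p i x where "t = (p, i, x)" "Factorial_Ring.prime p" "1 \<le> i" by (rule indexE)
  then show "ord_of t > 1" using prime_gt_1_nat[of p] one_less_power[of p i] by (simp add: ord_of_def)
qed

lemma ord_of_gt_0: "\<forall>t\<in>index. ord_of t > 0"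
  using ord_of_gt_1 by fastforce

lemma gen:
  assumes "(p, i, x) \<in> index"
  shows "gen (p, i, x) \<in> carrier G" "x = gen (p, i, x) [^] (p ^ (i - 1) :: nat)"
    "gen (p, i, x) [^] (p ^ i) = \<one>"
proof -
  have i: "1 \<le> i" and "x \<in> socle_layer G p (i - 1)" using assms by (auto elim: indexE)
  then have "\<exists>z. z \<in> carrier G \<and> x = z [^] (p ^ (i - 1) :: nat)" and xp: "x [^] p = \<one>"
    by (auto simp: socle_layer_def)
  from someI_ex[OF this(1)]
  show g: "gen (p, i, x) \<in> carrier G" "x = gen (p, i, x) [^] (p ^ (i - 1) :: nat)"
    by (auto simp: gen_def)
  have "p ^ i = p ^ (i - 1) * p" using i by (simp add: power_eq_if)
  then show "gen (p, i, x) [^] (p ^ i) = \<one>" using g xp by (simp flip: nat_pow_pow)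
qed

lemma gen_closed: "\<forall>t\<in>index. gen t \<in> carrier G"
  using gen(1) by auto

lemma gen_pow: "\<forall>t\<in>index. gen t [^] ord_of t = \<one>"
  using gen(3) by (auto simp: ord_of_def)

section \<open>The combination map is an isomorphism\<close>

abbreviation "C \<equiv> zmod_sum index ord_of"

lemma comb_hom: "combination G index gen \<in> hom C G"
  using gen_closed gen_pow by (rule combination_hom)

lemma group_hom_comb: "group_hom C G (combination G index gen)"
  using comb_hom comm_group_zmod_sum comm_group.axioms(2) is_group
  by (auto simp: group_hom_def group_hom_axioms_def)

text \<open>Independence excludes the identity, so an element of \<open>D p 0\<close> has order
  exactly \<open>p\<close>, and \<open>p\<close> divides \<open>N\<close>.\<close>

lemma finite_primes_occurring: "finite primes_occurring"
proof -
  have "p dvd N" if p: "p \<in> primes_occurring" for p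
  proof -
    have pr: "Factorial_Ring.prime p" using p by (simp add: primes_occurring_def)
    obtain x where x: "x \<in> D p 0" using p by (auto simp: primes_occurring_def)
    have xc: "x \<in> carrier G" "x [^] p = \<one>" using x D(1)[OF pr] by (auto simp: socle_layer_def)
    have "x \<noteq> \<one>"
    proof
      assume "x = \<one>"
      then have "finprod G (\<lambda>b. b [^] (1::int)) {x} = \<one>" by simp
      then have "\<forall>b\<in>{x}. int p dvd 1"
        using D(2)[OF pr, of 0] x unfolding p_independent_def
        by (elim allE[of _ "{x}"] allE[of _ "\<lambda>_. 1"]) simp
      then show False using pr by (auto simp: not_prime_unit)
    qed
    then have "ord x = p" using xc pr by (metis ord_eq_1 pow_eq_id prime_nat_iff)
    then show ?thesis using N(2) xc(1) pow_eq_id by blast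
  qed
  then have "primes_occurring \<subseteq> {d. d dvd N}" by blast
  then show ?thesis using finite_subset N(1) by fastforce
qed

lemma ord_of_dvd: "t \<in> index \<Longrightarrow> ord_of t dvd (\<Prod>p\<in>primes_occurring. p ^ height p)"
proof -
  assume t: "t \<in> index"
  obtain p i x where pix: "t = (p, i, x)" "p \<in> primes_occurring" "i \<le> height p"
    using t by (auto simp: index_def)
  have "p ^ i dvd p ^ height p" using pix(3) by (rule le_imp_power_dvd)
  also have "\<dots> dvd (\<Prod>p\<in>primes_occurring. p ^ height p)"
    using finite_primes_occurring pix(2) by (rule dvd_prodI)
  finally show ?thesis using pix(1) by (simp add: ord_of_def)
qed

text \<open>Being killed by \<open>p\<close> forces the coefficient at \<open>(p, i, x)\<close> to
  be a multiple of \<open>p ^ (i - 1)\<close>, which turns the power of \<open>gen\<close> into a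
  power of \<open>x\<close>. The combination becomes a relation in the independent set
  \<open>D p 0\<close>, and one more factor \<open>p\<close> in each coefficient makes it zero
  modulo \<open>p ^ i\<close>.\<close>

lemma comb_p_torsion:
  fixes p :: nat
  assumes p: "Factorial_Ring.prime p" and f: "f \<in> carrier C" "f [^]\<^bsub>C\<^esub> p = \<one>\<^bsub>C\<^esub>"
    and eq: "combination G index gen f = \<one>"
  shows "f = \<one>\<^bsub>C\<^esub>"
proof -
  note n0 = ord_of_gt_0
  have fc: "f \<in> extensional index" "\<And>t. t \<in> index \<Longrightarrow> 0 \<le> f t \<and> f t < int (ord_of t)"
    "finite {t \<in> index. f t \<noteq> 0}"
    using f(1) carrier_zmod_sum[OF n0] by auto
  have pf: "int (ord_of t) dvd int p * f t" if "t \<in> index" for t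
    using fun_cong[OF f(2), of t] pow_zmod_sum[OF f(1) n0] that
    by (simp add: one_zmod_sum mod_eq_0_iff_dvd)
  have zero: "f t = 0" if "t \<in> index" "int (ord_of t) dvd f t" for t
    using fc(2)[OF that(1)] that(2) by (metis zdvd_not_zless order_le_less)
  define F where "F = {t \<in> index. f t \<noteq> 0}"
  have F: "finite F" "F \<subseteq> index" using fc(3) by (auto simp: F_def)
  \<comment> \<open>For another prime the order of the summand is coprime to \<open>p\<close>, so it
    divides the coefficient itself.\<close>
  have Fp: "fst t = p" if t: "t \<in> F" for t
  proof (rule ccontr)
    assume np: "fst t \<noteq> p"
    have ti: "t \<in> index" using t F by blast
    obtain q i x where q: "t = (q, i, x)" "Factorial_Ring.prime q" using ti by (rule indexE)
    have "coprime q p" using primes_coprime[OF q(2) p] np q(1) by simp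
    then have "coprime (int (ord_of t)) (int p)" by (simp add: ord_of_def q(1))
    then have "int (ord_of t) dvd f t" using pf[OF ti] by (simp add: coprime_dvd_mult_right_iff)
    then show False using zero[OF ti] t by (simp add: F_def)
  qed
  define v where "v t = snd (snd t)" for t :: "nat \<times> nat \<times> 'a"
  \<comment> \<open>The chain \<open>D p\<close> decreases, so an element leaves it at one place
    only and determines its level.\<close>
  have inj: "inj_on v F"
  proof (rule inj_onI)
    fix s t assume st: "s \<in> F" "t \<in> F" "v s = v t"
    obtain i x where s: "s = (p, i, x)" using Fp[OF st(1)] by (cases s) auto
    obtain j where t: "t = (p, j, x)" using Fp[OF st(2)] st(3) s by (cases t) (auto simp: v_def)
    have "(p, i, x) \<in> index" "(p, j, x) \<in> index" using st s t F by auto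
    then have ij: "x \<in> D p (i - 1)" "x \<notin> D p i" "x \<in> D p (j - 1)" "x \<notin> D p j" "1 \<le> i" "1 \<le> j"
      by (auto elim: indexE)
    have "\<not> i \<le> j - 1" using D_antimono[OF p, of i "j - 1"] ij by blast
    moreover have "\<not> j \<le> i - 1" using D_antimono[OF p, of j "i - 1"] ij by blast
    ultimately have "i = j" using ij by linarith
    then show "s = t" using s t by simp
  qed
  define k where "k t = f t div int p ^ (fst (snd t) - 1)" for t
  have kt: "gen t [^] f t = v t [^] k t \<and> v t \<in> D p 0 \<and> f t = int p ^ (fst (snd t) - 1) * k t" if t: "t \<in> F" for t
  proof -
    obtain i x where t': "t = (p, i, x)" using Fp[OF t] by (cases t) auto
    have ti: "(p, i, x) \<in> index" using t t' F by auto
    then have i: "1 \<le> i" and x0: "x \<in> D p 0" by (auto elim: indexE)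
    have "int p * int p ^ (i - 1) dvd int p * f t"
    proof -
      have "int (ord_of t) = int p * int p ^ (i - 1)"
        using i unfolding t' ord_of_def by (cases i) simp_all
      then show ?thesis using pf[of t] ti t' by simp
    qed
    then have "int p ^ (i - 1) dvd f t" using prime_gt_0_nat[OF p] by simp
    then have fk: "f t = int (p ^ (i - 1)) * k t" using t' by (simp add: k_def)
    have "gen t [^] f t = (gen t [^] int (p ^ (i - 1))) [^] k t"
      unfolding fk using gen_closed ti t' by (simp only: int_pow_pow)
    also have "gen t [^] int (p ^ (i - 1)) = x" using gen(2)[OF ti] t' by (simp only: int_pow_int)
    finally show ?thesis using x0 fk t' by (simp add: v_def)
  qed
  have vc: "v t \<in> carrier G" if "t \<in> F" for t
    using kt[OF that] D(1)[OF p] by (auto simp: socle_layer_def)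
  \<comment> \<open>Coefficients are carried from indices to basis elements along the inverse of
    \<open>v\<close> on \<open>F\<close>, the form in which \<open>p_independent\<close>
    applies.\<close>
  define c where "c b = k (inv_into F v b)" for b
  have c: "c (v t) = k t" if "t \<in> F" for t using inj that by (simp add: c_def)
  have vk: "v t [^] c (v t) = gen t [^] f t" if "t \<in> F" for t
    using conjunct1[OF kt[OF that]] c[OF that] by simp
  have "finprod G (\<lambda>b. b [^] c b) (v ` F) = finprod G (\<lambda>t. v t [^] c (v t)) F"
    using inj vc by (intro finprod_reindex) auto
  also have "\<dots> = finprod G (\<lambda>t. gen t [^] f t) F"
    by (rule finprod_cong'[OF refl _ vk]) (use F gen_closed in auto)
  also have "\<dots> = combination G index gen f"
    using F gen_closed by (intro combination_eq_finprod[symmetric]) (auto simp: F_def)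
  finally have "finprod G (\<lambda>b. b [^] c b) (v ` F) = \<one>" using eq by simp
  moreover have "v ` F \<subseteq> D p 0" using kt by auto
  ultimately have dvd: "\<forall>b\<in>v ` F. int p dvd c b"
    using D(2)[OF p, of 0] F(1) unfolding p_independent_def by blast
  have "F = {}"
  proof (rule ccontr)
    assume "F \<noteq> {}"
    then obtain t where t: "t \<in> F" by blast
    obtain i x where t': "t = (p, i, x)" using Fp[OF t] by (cases t) auto
    have ti: "t \<in> index" using t F by auto
    then have i: "1 \<le> i" using t' by (auto elim: indexE)
    have "int p dvd k t" using bspec[OF dvd imageI[OF t]] c[OF t] by simp
    then have "int p ^ (i - 1) * int p dvd f t" using kt[OF t] t' by (auto intro: mult_dvd_mono)
    moreover have "int (ord_of t) = int p ^ (i - 1) * int p"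
      using i unfolding t' ord_of_def by (cases i) simp_all
    ultimately have "int (ord_of t) dvd f t" by simp
    then show False using zero[OF ti] t by (simp add: F_def)
  qed
  then have "f t = 0" if "t \<in> index" for t using that unfolding F_def by blast
  then show ?thesis using fc(1) by (auto simp: one_zmod_sum extensional_def)
qed

text \<open>\<open>C\<close> has a common exponent, so a nontrivial kernel element would have a
  power of prime order, still in the kernel, contrary to \<open>comb_p_torsion\<close>.\<close>

lemma comb_inj: "inj_on (combination G index gen) (carrier C)"
proof -
  interpret C: comm_group C by (rule comm_group_zmod_sum)
  interpret h: group_hom C G "combination G index gen" by (rule group_hom_comb)
  note n0 = ord_of_gt_0
  let ?M = "\<Prod>p\<in>primes_occurring. p ^ height p"
  have M: "?M > 0" by (auto simp: primes_occurring_def prime_gt_0_nat intro!: prod_pos)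
  show ?thesis
    unfolding h.inj_on_one_iff
  proof (intro allI impI)
    fix f assume f: "f \<in> carrier C" "combination G index gen f = \<one>"
    have "f [^]\<^bsub>C\<^esub> ?M = \<one>\<^bsub>C\<^esub>"
      unfolding pow_zmod_sum[OF f(1) n0] one_zmod_sum
    proof (rule restrict_ext)
      fix t assume "t \<in> index"
      then have "int (ord_of t) dvd int ?M" using ord_of_dvd by (simp only: int_dvd_int_iff)
      then show "int ?M * f t mod int (ord_of t) = 0" by simp
    qed
    then have "C.ord f dvd ?M" using f(1) C.pow_eq_id[of f ?M] by simp
    then have ord0: "C.ord f > 0" using M by (rule dvd_pos_nat[rotated])
    show "f = \<one>\<^bsub>C\<^esub>"
    proof (rule ccontr)
      assume "f \<noteq> \<one>\<^bsub>C\<^esub>"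
      then have "C.ord f \<noteq> 1" using f(1) C.ord_eq_1[of f] by simp
      then obtain p where p: "Factorial_Ring.prime p" "p dvd C.ord f" using prime_factor_nat by blast
      then obtain e where e: "C.ord f = p * e" by (elim dvdE)
      let ?g = "f [^]\<^bsub>C\<^esub> e"
      have "?g [^]\<^bsub>C\<^esub> p = f [^]\<^bsub>C\<^esub> C.ord f"
        using f(1) e by (simp only: C.nat_pow_pow mult.commute)
      also have "\<dots> = \<one>\<^bsub>C\<^esub>" using f(1) by (rule C.pow_ord_eq_1)
      finally have gp: "?g [^]\<^bsub>C\<^esub> p = \<one>\<^bsub>C\<^esub>" .
      have "combination G index gen ?g = \<one>" using f h.hom_nat_pow[OF f(1)] by simp
      then have "?g = \<one>\<^bsub>C\<^esub>" by (rule comb_p_torsion[OF p(1) C.nat_pow_closed[OF f(1)] gp])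
      then have "C.ord f dvd e" using f(1) C.pow_eq_id[of f e] by simp
      have "e > 0" using e ord0 by simp
      then have "p * e \<le> e" using \<open>C.ord f dvd e\<close> e by (simp only: dvd_imp_le)
      moreover have "2 * e \<le> p * e" using prime_ge_2_nat[OF p(1)] by (rule mult_le_mono1)
      ultimately show False using \<open>e > 0\<close> by linarith
    qed
  qed
qed

text \<open>With \<open>H\<close> the image, \<open>G[p] \<inter> p^j G \<subseteq> p^j H\<close>
  for all \<open>p\<close> and \<open>j\<close>. If \<open>n = p^(j+1) u\<close> kills
  \<open>g\<close>, some element of \<open>H\<close> has the same power as \<open>g\<close> for the
  exponent \<open>p^j u\<close>; their quotient is killed by this smaller number, and induction on
  \<open>n\<close> applies.\<close>

lemma comb_surj: "combination G index gen ` carrier C = carrier G"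
proof
  interpret C: comm_group C by (rule comm_group_zmod_sum)
  interpret h: group_hom C G "combination G index gen" by (rule group_hom_comb)
  define H where "H = combination G index gen ` carrier C"
  have H: "subgroup H G" unfolding H_def by (rule h.img_is_subgroup)
  then show "combination G index gen ` carrier C \<subseteq> carrier G" using subgroup.subset H_def by metis
  have genH: "gen t \<in> H" if "t \<in> index" for t
    unfolding H_def using combination_unit_vec[OF gen_closed that] unit_vec_closed[OF ord_of_gt_1 that] 
    by (metis imageI)
  have layer: "socle_layer G p j \<subseteq> (\<lambda>h. h [^] (p ^ j)) ` H" if p: "Factorial_Ring.prime p" for p j
  proof -
    have pow_hom: "group_hom G G (\<lambda>h. h [^] (p ^ j))"
      by unfold_locales (auto intro!: homI simp: nat_pow_distrib)
    have K: "subgroup ((\<lambda>h. h [^] (p ^ j)) ` H) G"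
      by (rule group_hom.subgroup_img_is_subgroup[OF pow_hom H])
    have "D p j \<subseteq> (\<lambda>h. h [^] (p ^ j)) ` H"
    proof
      fix x assume x: "x \<in> D p j"
      \<comment> \<open>The place where \<open>x\<close> leaves the chain. It lies beyond
        \<open>j\<close>, so \<open>x\<close>, a power of its generator with exponent
        \<open>p ^ (i - 1)\<close>, is the \<open>p ^ j\<close>-th power of an element of
        \<open>H\<close>.\<close>
      define i where "i = (LEAST i. x \<notin> D p i)"
      have xh: "x \<notin> D p (height p)" using D_height[OF p] by simp
      then have i1: "x \<notin> D p i" unfolding i_def by (rule LeastI)
      have ih: "i \<le> height p" unfolding i_def using xh by (rule Least_le)
      have ji: "j < i" using D_antimono[OF p, of i j] x i1 by (meson not_less subsetD)
      then have i2: "x \<in> D p (i - 1)" using not_less_Least[of "i - 1" "\<lambda>i. x \<notin> D p i"] i_def by auto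
      have "p \<in> primes_occurring" using p x D_antimono[OF p, of 0 j] by (auto simp: primes_occurring_def)
      then have t: "(p, i, x) \<in> index" using i1 i2 ih ji by (auto simp: index_def level_def)
      have "i - 1 = (i - 1 - j) + j" using ji by simp
      then have "x = (gen (p, i, x) [^] (p ^ (i - 1 - j))) [^] (p ^ j)"
        using gen(1,2)[OF t] by (metis nat_pow_pow power_add)
      moreover have "gen (p, i, x) [^] (p ^ (i - 1 - j)) \<in> H"
        using subgroup_int_pow_closed[OF H genH[OF t]] by (metis int_pow_int)
      ultimately show "x \<in> (\<lambda>h. h [^] (p ^ j)) ` H" by blast
    qed
    then show ?thesis using D(3)[OF p] generate_subgroup_incl[OF _ K] by (meson order_trans)
  qed
  have "\<And>g. g \<in> carrier G \<Longrightarrow> g [^] n = \<one> \<Longrightarrow> g \<in> H" if "n \<ge> 1" for n :: nat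
    using that
  proof (induction n rule: less_induct)
    case (less n)
    show ?case
    proof (cases "n = 1")
      case True
      then have "g = \<one>" using less.prems by simp
      then show ?thesis using subgroup.one_closed[OF H] by simp
    next
      case False
      then obtain p where p: "Factorial_Ring.prime p" "p dvd n" using prime_factor_nat by blast
      obtain u where u: "n = p ^ multiplicity p n * u" "\<not> p dvd u"
        using multiplicity_decompose'[of n p] less.prems(3) prime_gt_1_nat[OF p(1)] by auto
      \<comment> \<open>One factor \<open>p\<close> of \<open>n\<close> is kept aside, so that
        \<open>a\<close> below satisfies \<open>a [^] p = \<one>\<close>.\<close>
      define j where "j = multiplicity p n - 1"
      have "multiplicity p n > 0" using u p(2) by (metis gr0I mult_1 power_0)
      then have nj: "n = p * (p ^ j * u)" using u(1) unfolding j_def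
        by (metis Suc_pred' mult.assoc power_Suc)
      define a where "a = g [^] (p ^ j * u)"
      have ac: "a \<in> carrier G" using less.prems(1) by (simp add: a_def)
      have "a [^] p = g [^] n" unfolding a_def nj using less.prems(1) by (simp only: nat_pow_pow mult.commute)
      then have ap: "a [^] p = \<one>" using less.prems(2) by simp
      have "a = (g [^] u) [^] (p ^ j)" unfolding a_def using less.prems(1) by (simp only: nat_pow_pow mult.commute)
      then have "a \<in> socle_layer G p j" using ap ac less.prems(1) by (auto simp: socle_layer_def)
      then obtain h where h: "h \<in> H" "a = h [^] (p ^ j)" using layer[OF p(1)] by blast
      have hc: "h \<in> carrier G" using h(1) subgroup.subset[OF H] by blast
      have "coprime u p" using p(1) u(2) by (metis coprime_commute prime_imp_coprime)
      \<comment> \<open>Raising \<open>h\<close> to the power \<open>w\<close> offsets the factor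
        \<open>u\<close> of the exponent, since exponents of \<open>a\<close> count modulo
        \<open>p\<close>.\<close>
      then obtain w where w: "[u * w = 1] (mod p)" using cong_solve_coprime_nat[of u p] by auto
      have "(h [^] w) [^] (p ^ j * u) = a [^] (u * w)"
        unfolding h(2) using hc by (simp only: nat_pow_pow) (simp add: ac_simps)
      also have "\<dots> = a [^] int (u * w)" by (simp only: int_pow_int)
      also have "\<dots> = a [^] (int (u * w) mod int p)" by (rule int_pow_mod[OF ac ap, symmetric])
      also have "int (u * w) mod int p = 1 mod int p"
        using w by (metis cong_def of_nat_1 of_nat_mod)
      also have "a [^] (1 mod int p) = a" using ac ap int_pow_mod[of a p 1] by simp
      finally have hw: "(h [^] w) [^] (p ^ j * u) = a" .
      have hwH: "h [^] w \<in> H" using subgroup_int_pow_closed[OF H h(1)] by (metis int_pow_int)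
      have hwc: "h [^] w \<in> carrier G" using hc by simp
      let ?g = "g \<otimes> inv (h [^] w)"
      have "?g [^] (p ^ j * u) = a \<otimes> inv a"
        using less.prems(1) hwc hw by (simp add: nat_pow_distrib nat_pow_inv a_def)
      then have "?g [^] (p ^ j * u) = \<one>" using ac by simp
      moreover have "p ^ j * u < n" "p ^ j * u \<ge> 1"
        using nj less.prems(3) prime_gt_1_nat[OF p(1)] by (auto simp: Suc_le_eq)
      ultimately have "?g \<in> H" using less.prems(1) hwc by (intro less.IH[of "p ^ j * u"]) auto
      then have "?g \<otimes> h [^] w \<in> H" using hwH by (rule subgroup.m_closed[OF H])
      then show ?thesis using less.prems(1) hwc by (simp add: m_assoc)
    qed
  qed
  then show "carrier G \<subseteq> combination G index gen ` carrier C"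
    using N unfolding H_def by blast
qed

text \<open>Minimality of \<open>height p\<close> makes the top level, which is
  \<open>D p (height p - 1)\<close>, nonempty, as a leading index set must be.\<close>

lemma decomposition: "cyclic_decomposition G primes_occurring height level"
proof -
  have "height p \<ge> 1 \<and> level p (height p) \<noteq> {}" if p: "p \<in> primes_occurring" for p
  proof -
    have pr: "Factorial_Ring.prime p" and D0: "D p 0 \<noteq> {}" using p by (auto simp: primes_occurring_def)
    have h1: "height p \<ge> 1" using D0 D_height[OF pr] by (metis less_one not_le)
    then have "D p (height p - 1) \<noteq> {}"
      using not_less_Least[of "height p - 1" "\<lambda>i. D p i = {}"] by (auto simp: height_def)
    then show ?thesis using h1 D_height[OF pr] by (simp add: level_def)
  qed
  moreover have "cyclic_sum primes_occurring height level = C"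
    by (simp only: cyclic_sum_eq_zmod_sum index_def ord_of_def)
  moreover have "G \<cong> C"
  proof -
    have "combination G index gen \<in> iso C G"
      using comb_hom comb_inj comb_surj by (simp add: iso_def bij_betw_def)
    then have "C \<cong> G" by (rule is_isoI)
    then show ?thesis using group.iso_sym[of C G] comm_group_zmod_sum comm_group.axioms(2) by blast
  qed
  ultimately show ?thesis
    using finite_primes_occurring by (auto simp: cyclic_decomposition_def primes_occurring_def)
qed

end

text \<open>The Pruefer-Baer theorem. One annihilating \<open>N\<close> bounds the heights for all
  primes, and the chains of bases are chosen prime by prime.\<close>

theorem (in comm_group) ex_cyclic_decomposition:
  assumes "bounded_group G"
  shows "\<exists>P m A. cyclic_decomposition G P m A"
proof -
  obtain N :: nat where N: "N \<ge> 1" "\<And>x. x \<in> carrier G \<Longrightarrow> x [^] N = \<one>"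
    using assms by (auto simp: bounded_group_def)
  have "\<forall>p. \<exists>D :: nat \<Rightarrow> 'a set. Factorial_Ring.prime p \<longrightarrow> (\<forall>j. D j \<subseteq> socle_layer G p j \<and>
      p_independent G p (D j) \<and> socle_layer G p j \<subseteq> generate G (D j) \<and> D (Suc j) \<subseteq> D j) \<and> D N = {}"
    using socle_basis_chain[OF _ N] by blast
  then obtain D :: "nat \<Rightarrow> nat \<Rightarrow> 'a set" where D: "\<forall>p. Factorial_Ring.prime p \<longrightarrow> (\<forall>j. D p j \<subseteq> socle_layer G p j \<and>
      p_independent G p (D p j) \<and> socle_layer G p j \<subseteq> generate G (D p j) \<and> D p (Suc j) \<subseteq> D p j) \<and> D p N = {}"
    by (elim choice[THEN exE])
  interpret cyclic_basis G N D
    by unfold_locales (use N D in blast)+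
  show ?thesis using decomposition by blast
qed

subsection \<open>Characters\<close>

lemma circle_proj_eq: "circle_proj x = {z. z - x \<in> \<int>}"
proof -
  have "circle_proj x = (\<lambda>h. h + x) ` \<int>" by (auto simp: circle_proj_def r_coset_def real_group_def)
  also have "\<dots> = {z. z - x \<in> \<int>}" by (auto intro: image_eqI[of _ _ "_ - x"])
  finally show ?thesis .
qed

lemma circle_proj_eq_iff: "circle_proj x = circle_proj y \<longleftrightarrow> x - y \<in> \<int>"
proof
  assume "circle_proj x = circle_proj y"
  moreover have "x \<in> circle_proj x" by (simp add: circle_proj_eq)
  ultimately show "x - y \<in> \<int>" by (simp add: circle_proj_eq)
next
  assume xy: "x - y \<in> \<int>"
  have "z - x \<in> \<int> \<longleftrightarrow> z - y \<in> \<int>" for z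
    using Ints_add[OF _ xy, of "z - x"] Ints_diff[OF _ xy, of "z - y"] by auto
  then show "circle_proj x = circle_proj y" by (simp add: circle_proj_eq)
qed

lemma comm_group_real_group: "comm_group real_group"
proof (rule comm_groupI)
  show "\<exists>y\<in>carrier real_group. y \<otimes>\<^bsub>real_group\<^esub> x = \<one>\<^bsub>real_group\<^esub>" for x
    by (rule bexI[of _ "- x"]) (simp_all add: real_group_def)
qed (simp_all add: real_group_def)

lemma normal_Ints: "\<int> \<lhd> real_group"
proof -
  interpret comm_group real_group by (rule comm_group_real_group)
  have inv: "inv\<^bsub>real_group\<^esub> x = - x" for x by (rule inv_equality) (simp_all add: real_group_def)
  have "subgroup \<int> real_group" by unfold_locales (auto simp: inv, auto simp: real_group_def)
  then show ?thesis by (rule subgroup_imp_normal)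
qed

lemma comm_group_circle_group: "comm_group circle_group"
  unfolding circle_group_def using comm_group.abelian_FactGroup[OF comm_group_real_group]
    normal_imp_subgroup[OF normal_Ints] by blast

lemma circle_proj_add: "circle_proj x \<otimes>\<^bsub>circle_group\<^esub> circle_proj y = circle_proj (x + y)"
  unfolding circle_group_def circle_proj_def
  using normal.rcos_sum[OF normal_Ints, of x y] by (simp add: real_group_def)

lemma circle_proj_0: "circle_proj 0 = \<one>\<^bsub>circle_group\<^esub>"
  by (simp add: circle_group_def circle_proj_eq)

lemma circle_proj_closed: "circle_proj x \<in> carrier circle_group"
  by (simp add: carrier_circle_group)

text \<open>Projection to a cyclic summand in which \<open>g\<close> has a nonzero coordinate,
  followed by \<open>k \<mapsto> k / n t\<close> modulo the integers.\<close>

lemma (in comm_group) ex_separating_circle_hom: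
  assumes "bounded_group G" "g \<in> carrier G" "g \<noteq> \<one>"
  shows "\<exists>\<psi>\<in>hom G circle_group. \<psi> g \<noteq> \<one>\<^bsub>circle_group\<^esub>"
proof -
  obtain P m and A :: "nat \<Rightarrow> nat \<Rightarrow> 'a set" where dec: "cyclic_decomposition G P m A"
    using ex_cyclic_decomposition[OF assms(1)] by blast
  define I where "I = (SIGMA p:P. SIGMA i:{1..m p}. A p i)"
  define n where "n = (\<lambda>(p, i, _::'a). p ^ i :: nat)"
  let ?C = "zmod_sum I n"
  have pr: "\<forall>p\<in>P. Factorial_Ring.prime p" using dec by (simp add: cyclic_decomposition_def)
  then have n0: "\<forall>t\<in>I. n t > 0" by (auto simp: I_def n_def prime_gt_0_nat)
  obtain \<phi> where \<phi>: "\<phi> \<in> iso G ?C"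
    using dec unfolding cyclic_decomposition_def is_iso_def cyclic_sum_eq_zmod_sum I_def n_def by blast
  then have hom: "\<phi> \<in> hom G ?C" and inj: "inj_on \<phi> (carrier G)" by (auto simp: iso_def bij_betw_def)
  have one: "\<phi> \<one> = \<one>\<^bsub>?C\<^esub>"
    using hom comm_group_zmod_sum comm_group.axioms(2) is_group by (intro hom_one) blast+
  have "\<phi> g \<noteq> \<one>\<^bsub>?C\<^esub>" using inj_onD[OF inj, of g \<one>] one assms by auto
  moreover have cg: "\<phi> x \<in> extensional I" "\<forall>t\<in>I. 0 \<le> \<phi> x t \<and> \<phi> x t < int (n t)" if "x \<in> carrier G" for x
    using hom_in_carrier[OF hom that] carrier_zmod_sum[OF n0, of "\<phi> x"] by auto
  ultimately obtain t where t: "t \<in> I" "\<phi> g t \<noteq> 0"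
    using assms(2) by (fastforce simp: one_zmod_sum extensional_def)
  define \<psi> where "\<psi> x = circle_proj (real_of_int (\<phi> x t) / real (n t))" for x
  have nt: "n t > 0" using n0 t by blast
  have "\<psi> \<in> hom G circle_group"
  proof (rule homI)
    show "\<psi> x \<in> carrier circle_group" for x by (simp add: \<psi>_def circle_proj_closed)
    fix x y assume xy: "x \<in> carrier G" "y \<in> carrier G"
    let ?a = "\<phi> x t + \<phi> y t"
    have "\<phi> (x \<otimes> y) t = ?a mod int (n t)"
      using hom_mult[OF hom xy] t(1) by (simp add: mult_zmod_sum)
    moreover have "real_of_int (?a mod int (n t)) / real (n t) - (real_of_int (\<phi> x t) / real (n t) + real_of_int (\<phi> y t) / real (n t))
        = - real_of_int (?a div int (n t))"
    proof -
      have "real_of_int ?a = real_of_int (?a div int (n t)) * real (n t) + real_of_int (?a mod int (n t))"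
        by (metis div_mult_mod_eq of_int_add of_int_mult of_int_of_nat_eq)
      then show ?thesis using nt by (simp add: field_simps)
    qed
    ultimately show "\<psi> (x \<otimes> y) = \<psi> x \<otimes>\<^bsub>circle_group\<^esub> \<psi> y"
      unfolding \<psi>_def circle_proj_add circle_proj_eq_iff by simp
  qed
  moreover have "\<psi> g \<noteq> \<one>\<^bsub>circle_group\<^esub>"
  proof
    assume "\<psi> g = \<one>\<^bsub>circle_group\<^esub>"
    then have "real_of_int (\<phi> g t) / real (n t) \<in> \<int>"
      unfolding \<psi>_def circle_proj_0[symmetric] circle_proj_eq_iff by simp
    then obtain k where "real_of_int (\<phi> g t) / real (n t) = real_of_int k" by (elim Ints_cases)
    then have "real_of_int (\<phi> g t) = real_of_int (k * int (n t))" using nt by (simp add: field_simps)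
    then have "\<phi> g t = k * int (n t)" by (simp only: of_int_eq_iff)
    then have "int (n t) dvd \<phi> g t" by simp
    moreover have "0 < \<phi> g t" "\<phi> g t < int (n t)" using cg(2)[OF assms(2)] t by force+
    ultimately show False using zdvd_not_zless by blast
  qed
  ultimately show ?thesis by blast
qed

section \<open>Consequences for power images and for leading invariants\<close>

lemma (in comm_group) continuous_map_nat_pow:
  assumes "group_topology G T"
  shows "continuous_map T T (\<lambda>x. x [^] (n::nat))"
proof (induction n)
  case 0
  then show ?case using assms by (simp add: group_topology_def)
next
  case (Suc n)
  have "continuous_map T T ((\<lambda>(x, y). x \<otimes> y) \<circ> (\<lambda>x. (x [^] n, x)))"
    using assms Suc by (intro continuous_map_compose) (auto simp: group_topology_def continuous_map_paired)
  then show ?case by (simp add: o_def)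
qed

text \<open>If \<open>n G\<close> is finite, \<open>x \<mapsto> \<psi> (x [^] n)\<close> is
  continuous for every homomorphism \<open>\<psi>\<close> to the circle, and \<open>\<psi>\<close>
  can be chosen to detect a given nontrivial power.\<close>

lemma (in comm_group) minimally_almost_periodic_imp_power_images:
  assumes "bounded_group G" and T: "group_topology G T" "Hausdorff_space T"
    and map: "minimally_almost_periodic G T"
  shows "power_images_trivial_or_infinite G"
  unfolding power_images_trivial_or_infinite_def
proof (intro allI impI ballI, rule ccontr)
  fix n :: nat and g
  assume fin: "finite ((\<lambda>x. x [^] n) ` carrier G)" and g: "g \<in> carrier G" "g [^] n \<noteq> \<one>"
  obtain \<psi> where \<psi>: "\<psi> \<in> hom G circle_group" "\<psi> (g [^] n) \<noteq> \<one>\<^bsub>circle_group\<^esub>"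
    using ex_separating_circle_hom[OF assms(1) _ g(2)] g(1) by auto
  have top: "topspace T = carrier G" using T(1) by (simp add: group_topology_def)
  define h where "h x = \<psi> (x [^] n)" for x
  have "h \<in> hom G circle_group"
    using \<psi>(1) by (auto simp: h_def hom_def nat_pow_distrib Pi_def)
  moreover have "continuous_map T circle_topology h"
    unfolding continuous_map_def topspace_circle_topology
  proof (intro conjI allI impI)
    show "h \<in> topspace T \<rightarrow> carrier circle_group" using \<psi>(1) top by (auto simp: h_def hom_def)
    fix U assume "openin circle_topology U"
    \<comment> \<open>The finitely many powers that \<open>\<psi>\<close> sends outside
      \<open>U\<close>; finite sets are closed in a Hausdorff space.\<close>
    let ?K = "{a \<in> (\<lambda>x. x [^] n) ` carrier G. \<psi> a \<notin> U}"
    have "closedin T {x \<in> topspace T. x [^] n \<in> ?K}"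
    proof (rule closedin_continuous_map_preimage[OF continuous_map_nat_pow[OF T(1)]])
      have "?K \<subseteq> topspace T" using top by auto
      moreover have "finite ?K" using fin by simp
      ultimately show "closedin T ?K"
        using Hausdorff_imp_t1_space[OF T(2)] t1_space_closedin_finite by blast
    qed
    then have "openin T (topspace T - {x \<in> topspace T. x [^] n \<in> ?K})" by (rule openin_diff[OF openin_topspace])
    moreover have "topspace T - {x \<in> topspace T. x [^] n \<in> ?K} = {x \<in> topspace T. h x \<in> U}"
      using top by (auto simp: h_def)
    ultimately show "openin T {x \<in> topspace T. h x \<in> U}" by simp
  qed
  ultimately have "h g = \<one>\<^bsub>circle_group\<^esub>"
    using map g(1) by (simp add: minimally_almost_periodic_def character_def)
  with \<psi>(2) show False by (simp add: h_def)
qed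

text \<open>If the leading index set at \<open>p\<close> were finite, the exponent
  \<open>M = p ^ (m p - 1) * R\<close>, with \<open>R\<close> collecting the other primes, would
  kill all but the finitely many summands of order \<open>p ^ m p\<close>. Then \<open>M G\<close>
  would be finite, yet nontrivial, because \<open>p ^ m p\<close> does not divide
  \<open>M\<close>.\<close>

lemma (in comm_group) infinite_leading_index_set:
  assumes d: "power_images_trivial_or_infinite G" and dec: "cyclic_decomposition G P m A" and p: "p \<in> P"
  shows "infinite (A p (m p))"
proof
  assume fin: "finite (A p (m p))"
  define I where "I = (SIGMA p:P. SIGMA i:{1..m p}. A p i)"
  define n where "n = (\<lambda>(p, i, _::'a). p ^ i :: nat)"
  let ?C = "zmod_sum I n"
  have P: "finite P" "\<forall>q\<in>P. Factorial_Ring.prime q \<and> m q \<ge> 1 \<and> A q (m q) \<noteq> {}"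
    using dec by (simp_all add: cyclic_decomposition_def)
  have pp: "Factorial_Ring.prime p" "m p \<ge> 1" using P p by auto
  have n1: "\<forall>t\<in>I. n t > 1"
  proof
    fix t assume "t \<in> I"
    then obtain q i x where "t = (q, i, x)" "Factorial_Ring.prime q" "1 \<le> i" using P by (auto simp: I_def)
    then show "n t > 1" using prime_gt_1_nat[of q] one_less_power[of q i] by (simp add: n_def)
  qed
  then have n0: "\<forall>t\<in>I. n t > 0" by fastforce
  obtain \<phi> where \<phi>: "\<phi> \<in> iso G ?C"
    using dec unfolding cyclic_decomposition_def is_iso_def cyclic_sum_eq_zmod_sum I_def n_def by blast
  then have hom: "\<phi> \<in> hom G ?C" and inj: "inj_on \<phi> (carrier G)" and surj: "\<phi> ` carrier G = carrier ?C"
    by (auto simp: iso_def bij_betw_def)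
  have gC: "group ?C" using comm_group_zmod_sum comm_group.axioms(2) by blast
  define R where "R = (\<Prod>q\<in>P - {p}. q ^ m q)"
  define M where "M = p ^ (m p - 1) * R"
  define F where "F = {p} \<times> {m p} \<times> A p (m p)"
  have FI: "F \<subseteq> I" using p pp by (auto simp: F_def I_def)
  have dvd: "n t dvd M" if t: "t \<in> I" "t \<notin> F" for t
  proof -
    obtain q i x where q: "t = (q, i, x)" "q \<in> P" "1 \<le> i" "i \<le> m q" "x \<in> A q i"
      using t(1) by (auto simp: I_def)
    show ?thesis
    proof (cases "q = p")
      case True
      then have "i \<le> m p - 1" using q t(2) by (cases "i = m p") (auto simp: F_def)
      then have "p ^ i dvd p ^ (m p - 1)" by (rule le_imp_power_dvd)
      then show ?thesis using q(1) True by (simp add: n_def M_def)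
    next
      case False
      have "q ^ i dvd q ^ m q" using q(4) by (rule le_imp_power_dvd)
      also have "q ^ m q dvd R" unfolding R_def using P(1) q(2) False by (intro dvd_prodI) auto
      finally show ?thesis using q(1) by (simp add: n_def M_def)
    qed
  qed
  have pow: "\<phi> (x [^] M) = (\<lambda>t\<in>I. (int M * \<phi> x t) mod int (n t))" if "x \<in> carrier G" for x
    using hom_nat_pow[OF hom that is_group gC] pow_zmod_sum[OF hom_in_carrier[OF hom that] n0] by simp
  \<comment> \<open>Elements supported on the finite set \<open>F\<close>; restriction to
    \<open>F\<close> embeds them in a finite product.\<close>
  define S where "S = {f \<in> carrier ?C. \<forall>t\<in>I - F. f t = 0}"
  have "finite S"
  proof (rule inj_on_finite)
    show "inj_on (\<lambda>f. restrict f F) S"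
    proof (rule inj_onI)
      fix f g assume fg: "f \<in> S" "g \<in> S" "restrict f F = restrict g F"
      have "f \<in> extensional I" "g \<in> extensional I"
        using fg(1,2) carrier_zmod_sum[OF n0] by (auto simp: S_def)
      moreover have "f t = g t" if "t \<in> I" for t
        using fg that by (cases "t \<in> F") (auto simp: S_def dest: fun_cong[of _ _ t])
      ultimately show "f = g" by (rule extensionalityI)
    qed
    show "(\<lambda>f. restrict f F) ` S \<subseteq> (\<Pi>\<^sub>E t\<in>F. {0..<int (n t)})"
      using FI carrier_zmod_sum[OF n0] by (auto simp: S_def)
    show "finite (\<Pi>\<^sub>E t\<in>F. {0..<int (n t)})" using fin by (intro finite_PiE) (auto simp: F_def)
  qed
  moreover have "\<phi> ` (\<lambda>x. x [^] M) ` carrier G \<subseteq> S"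
  proof clarify
    fix x assume x: "x \<in> carrier G"
    have "\<phi> (x [^] M) \<in> carrier ?C" using x by (intro hom_in_carrier[OF hom]) simp
    moreover have "\<phi> (x [^] M) t = 0" if "t \<in> I - F" for t
    proof -
      have "int (n t) dvd int M" using dvd that by (simp only: int_dvd_int_iff) simp
      then show ?thesis using that by (simp add: pow[OF x])
    qed
    ultimately show "\<phi> (x [^] M) \<in> S" by (simp add: S_def)
  qed
  ultimately have "finite (\<phi> ` (\<lambda>x. x [^] M) ` carrier G)" by (rule finite_subset[rotated])
  moreover have "inj_on \<phi> ((\<lambda>x. x [^] M) ` carrier G)" by (rule inj_on_subset[OF inj]) auto
  ultimately have "finite ((\<lambda>x. x [^] M) ` carrier G)" by (rule finite_imageD)
  then have triv: "\<forall>x\<in>carrier G. x [^] M = \<one>" using d unfolding power_images_trivial_or_infinite_def by blast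
  obtain a where a: "a \<in> A p (m p)" using P p by blast
  define t where "t = (p, m p, a)"
  have t: "t \<in> I" using a p pp by (auto simp: t_def I_def)
  \<comment> \<open>\<open>x\<close> corresponds to the generator of a leading summand, whose
    \<open>M\<close>-th power ought to survive.\<close>
  obtain x where x: "x \<in> carrier G" "\<phi> x = unit_vec I t"
    using unit_vec_closed[OF n1 t] unfolding surj[symmetric] by auto
  have "\<phi> (x [^] M) = \<one>\<^bsub>?C\<^esub>" using triv x(1) hom_one[OF hom is_group gC] by simp
  then have "\<phi> (x [^] M) t = 0" using t by (simp add: one_zmod_sum)
  then have "(int M * unit_vec I t t) mod int (n t) = 0"
    unfolding pow[OF x(1)] x(2) using t by simp
  then have "int (n t) dvd int M" using t by (simp add: unit_vec_def mod_eq_0_iff_dvd)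
  then have "p ^ m p dvd p ^ (m p - 1) * R" unfolding int_dvd_int_iff by (simp add: t_def n_def M_def)
  moreover have "p ^ m p = p ^ (m p - 1) * p" using pp(2) by (cases "m p") simp_all
  ultimately have "p dvd R" using prime_gt_0_nat[OF pp(1)] by simp
  then have "\<exists>q\<in>P - {p}. p dvd q ^ m q"
    unfolding R_def using prime_dvd_prod_iff[of "P - {p}" p "\<lambda>q. q ^ m q"] P(1) pp(1) by simp
  then obtain q where q: "q \<in> P - {p}" "p dvd q ^ m q" by blast
  then have "p dvd q" using pp(1) prime_dvd_power by blast
  then have "p = q" using q(1) P(2) pp(1) primes_dvd_imp_eq by blast
  with q(1) show False by simp
qed

subsection \<open>Norms with generating balls\<close>

lemma circle_proj_pow: "circle_proj t [^]\<^bsub>circle_group\<^esub> (k::nat) = circle_proj (real k * t)"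
proof (induction k)
  case 0
  then show ?case by (simp add: circle_proj_0)
next
  case (Suc k)
  then show ?case by (simp add: circle_proj_add algebra_simps)
qed

text \<open>The projection is open: the preimage of the image of \<open>S\<close> is the union of
  the integer translates of \<open>S\<close>.\<close>

lemma openin_circle_proj_image:
  assumes "open S"
  shows "openin circle_topology (circle_proj ` S)"
  unfolding openin_circle_topology
proof
  show "circle_proj ` S \<subseteq> carrier circle_group" by (auto simp: circle_proj_closed)
  have "{x. circle_proj x \<in> circle_proj ` S} = (\<Union>k\<in>\<int>. (\<lambda>t. k + t) ` S)"
  proof (intro equalityI subsetI)
    fix x assume "x \<in> {x. circle_proj x \<in> circle_proj ` S}"
    then obtain t where "t \<in> S" "x - t \<in> \<int>" by (auto simp: circle_proj_eq_iff)
    then show "x \<in> (\<Union>k\<in>\<int>. (\<lambda>t. k + t) ` S)" by (intro UN_I[of "x - t"] image_eqI[of _ _ t]) auto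
  next
    fix x assume "x \<in> (\<Union>k\<in>\<int>. (\<lambda>t. k + t) ` S)"
    then obtain k t where "k \<in> \<int>" "t \<in> S" "x = k + t" by blast
    then have "circle_proj x = circle_proj t" by (simp add: circle_proj_eq_iff)
    then show "x \<in> {x. circle_proj x \<in> circle_proj ` S}" using \<open>t \<in> S\<close> by simp
  qed
  then show "open {x. circle_proj x \<in> circle_proj ` S}"
    using assms by (simp add: open_UN open_translation)
qed

text \<open>The norm gives an invariant metric. A character maps some ball into a short arc whose
  only element killed by the exponent of \<open>G\<close> is the identity; the ball then lies in the
  kernel, and a subgroup containing a ball is everything.\<close>

lemma (in comm_group) minimally_almost_periodic_of_norm:
  fixes \<nu> :: "'a \<Rightarrow> real"
  assumes "bounded_group G"
    and nonneg: "\<And>x. x \<in> carrier G \<Longrightarrow> 0 \<le> \<nu> x" and one: "\<nu> \<one> = 0"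
    and definite: "\<And>x. x \<in> carrier G \<Longrightarrow> \<nu> x = 0 \<Longrightarrow> x = \<one>"
    and inv: "\<And>x. x \<in> carrier G \<Longrightarrow> \<nu> (inv x) = \<nu> x"
    and mult: "\<And>x y. x \<in> carrier G \<Longrightarrow> y \<in> carrier G \<Longrightarrow> \<nu> (x \<otimes> y) \<le> \<nu> x + \<nu> y"
    and ball: "\<And>\<epsilon> H. \<epsilon> > 0 \<Longrightarrow> subgroup H G \<Longrightarrow> {x \<in> carrier G. \<nu> x < \<epsilon>} \<subseteq> H \<Longrightarrow> H = carrier G"
  shows "\<exists>T. group_topology G T \<and> Hausdorff_space T \<and> minimally_almost_periodic G T"
proof -
  \<comment> \<open>Zero off the carrier, since \<open>Metric_space\<close> asks for nonnegativity
    and symmetry at all points of the type.\<close>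
  define d where "d x y = (if x \<in> carrier G \<and> y \<in> carrier G then \<nu> (x \<otimes> inv y) else 0)" for x y
  interpret M: Metric_space "carrier G" d
  proof
    fix x y
    show "0 \<le> d x y" by (simp add: d_def nonneg)
    show "d x y = d y x"
    proof (cases "x \<in> carrier G \<and> y \<in> carrier G")
      case True
      then have "inv (x \<otimes> inv y) = y \<otimes> inv x" by (simp add: inv_mult_group)
      then show ?thesis using True inv[of "x \<otimes> inv y"] by (simp add: d_def)
    qed (auto simp: d_def)
  next
    fix x y assume xy: "x \<in> carrier G" "y \<in> carrier G"
    show "d x y = 0 \<longleftrightarrow> x = y"
    proof
      assume "d x y = 0"
      then have "x \<otimes> inv y = \<one>" using xy by (intro definite) (simp_all add: d_def)
      then show "x = y" using xy inv_equality[of x "inv y"] by simp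
    qed (use xy one in \<open>simp add: d_def\<close>)
    fix z assume z: "z \<in> carrier G"
    have "x \<otimes> inv z = (x \<otimes> inv y) \<otimes> (y \<otimes> inv z)"
      using xy z by (metis inv_closed inv_solve_left m_assoc m_closed)
    then show "d x z \<le> d x y + d y z" using mult[of "x \<otimes> inv y" "y \<otimes> inv z"] xy z by (simp add: d_def)
  qed
  let ?T = "M.mtopology"
  have "group_topology G ?T"
    unfolding group_topology_def
  proof (intro conjI)
    show "topspace ?T = carrier G" by simp
    show "continuous_map (prod_topology ?T ?T) ?T (\<lambda>(x, y). x \<otimes> y)"
      unfolding M.continuous_map_to_metric
    proof (intro ballI allI impI)
      fix z and \<epsilon> :: real assume z: "z \<in> topspace (prod_topology ?T ?T)" and \<epsilon>: "\<epsilon> > 0"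
      obtain x y where xy: "z = (x, y)" "x \<in> carrier G" "y \<in> carrier G" using z by auto
      let ?U = "M.mball x (\<epsilon> / 2) \<times> M.mball y (\<epsilon> / 2)"
      have "x' \<otimes> y' \<in> M.mball (x \<otimes> y) \<epsilon>" if xy': "x' \<in> M.mball x (\<epsilon> / 2)" "y' \<in> M.mball y (\<epsilon> / 2)" for x' y'
      proof -
        have c: "x' \<in> carrier G" "y' \<in> carrier G" using xy' by auto
        have "(x \<otimes> y) \<otimes> inv (x' \<otimes> y') = (x \<otimes> inv x') \<otimes> (y \<otimes> inv y')"
          using xy(2,3) c by (simp add: inv_mult m_ac)
        then have "d (x \<otimes> y) (x' \<otimes> y') \<le> d x x' + d y y'"
          using mult[of "x \<otimes> inv x'" "y \<otimes> inv y'"] xy(2,3) c by (simp add: d_def)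
        also have "\<dots> < \<epsilon>" using xy' by simp
        finally show ?thesis using xy(2,3) c by simp
      qed
      then have "\<forall>w\<in>?U. (\<lambda>(x, y). x \<otimes> y) w \<in> M.mball ((\<lambda>(x, y). x \<otimes> y) z) \<epsilon>"
        unfolding xy(1) by auto
      moreover have "openin (prod_topology ?T ?T) ?U" by (simp add: openin_prod_Times_iff)
      moreover have "z \<in> ?U" using xy \<epsilon> by simp
      ultimately show "\<exists>U. openin (prod_topology ?T ?T) U \<and> z \<in> U \<and>
          (\<forall>w\<in>U. (\<lambda>(x, y). x \<otimes> y) w \<in> M.mball ((\<lambda>(x, y). x \<otimes> y) z) \<epsilon>)"
        by (intro exI[of _ ?U] conjI)
    qed
    show "continuous_map ?T ?T (\<lambda>x. inv x)"
      unfolding M.continuous_map_to_metric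
    proof (intro ballI allI impI)
      fix x and \<epsilon> :: real assume x: "x \<in> topspace ?T" and \<epsilon>: "\<epsilon> > 0"
      have "inv y \<in> M.mball (inv x) \<epsilon>" if y: "y \<in> M.mball x \<epsilon>" for y
      proof -
        have c: "x \<in> carrier G" "y \<in> carrier G" using x y by auto
        have "inv x \<otimes> inv (inv y) = inv (x \<otimes> inv y)" using c by (simp add: inv_mult)
        then have "d (inv x) (inv y) = d x y" using c inv[of "x \<otimes> inv y"] by (simp add: d_def)
        then show ?thesis using c y by simp
      qed
      then show "\<exists>U. openin ?T U \<and> x \<in> U \<and> (\<forall>y\<in>U. inv y \<in> M.mball (inv x) \<epsilon>)"
        using x \<epsilon> by (intro exI[of _ "M.mball x \<epsilon>"]) simp
    qed
  qed
  moreover have "minimally_almost_periodic G ?T"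
    unfolding minimally_almost_periodic_def
  proof (intro allI impI)
    fix h assume "character G ?T h"
    then have h: "h \<in> hom G circle_group" "continuous_map ?T circle_topology h"
      by (simp_all add: character_def)
    interpret h: group_hom G circle_group h
      using h(1) comm_group_circle_group is_group
      by (simp add: group_hom_def group_hom_axioms_def comm_group.axioms(2))
    obtain m :: nat where m: "m \<ge> 1" "\<And>x. x \<in> carrier G \<Longrightarrow> x [^] m = \<one>"
      using assms(1) by (auto simp: bounded_group_def)
    \<comment> \<open>Radius \<open>1 / m\<close>: if \<open>m\<close> kills the class of
      \<open>t\<close>, then \<open>m t\<close> is an integer of absolute value below
      \<open>1\<close>, so \<open>t = 0\<close>.\<close>
    define V where "V = circle_proj ` {- 1 / real m<..<1 / real m}"
    have no_torsion: "c = \<one>\<^bsub>circle_group\<^esub>" if c: "c \<in> V" "c [^]\<^bsub>circle_group\<^esub> m = \<one>\<^bsub>circle_group\<^esub>" for c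
    proof -
      obtain t where t: "c = circle_proj t" "- 1 / real m < t" "t < 1 / real m" using c(1) by (auto simp: V_def)
      have "real m * t \<in> \<int>"
        using c(2) by (simp add: t(1) circle_proj_pow circle_proj_eq_iff flip: circle_proj_0)
      moreover have "\<bar>real m * t\<bar> < 1" using t(2,3) m(1) by (simp add: field_simps abs_less_iff)
      ultimately have "real m * t = 0" by (rule Ints_nonzero_abs_less1)
      then show ?thesis using m(1) t(1) by (simp add: circle_proj_0)
    qed
    let ?U = "{x \<in> topspace ?T. h x \<in> V}"
    have "openin ?T ?U"
      using h(2) openin_circle_proj_image[OF open_greaterThanLessThan] unfolding V_def
      by (rule openin_continuous_map_preimage)
    moreover have "\<one> \<in> ?U"
      using m(1) by (auto simp: V_def h.hom_one simp flip: circle_proj_0 intro!: imageI)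
    ultimately obtain \<epsilon> where \<epsilon>: "\<epsilon> > 0" "M.mball \<one> \<epsilon> \<subseteq> ?U"
      unfolding M.openin_mtopology by blast
    have "kernel G circle_group h = carrier G"
    proof (rule ball[OF \<epsilon>(1) h.subgroup_kernel], clarify)
      fix x assume x: "x \<in> carrier G" "\<nu> x < \<epsilon>"
      then have "x \<in> M.mball \<one> \<epsilon>" using inv[of x] by (simp add: d_def)
      then have "h x \<in> V" using \<epsilon>(2) by blast
      moreover have "h x [^]\<^bsub>circle_group\<^esub> m = \<one>\<^bsub>circle_group\<^esub>"
        using h.hom_nat_pow[OF x(1), of m] m(2)[OF x(1)] by simp
      ultimately show "x \<in> kernel G circle_group h" using no_torsion x(1) by (simp add: kernel_def)
    qed
    then show "\<forall>x\<in>carrier G. h x = \<one>\<^bsub>circle_group\<^esub>" by (auto simp: kernel_def)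
  qed
  ultimately show ?thesis using M.Hausdorff_space_mtopology by blast
qed

subsection \<open>A norm of step functions\<close>

text \<open>\<open>lab\<close> is the block of a summand, \<open>pos\<close> the end point of its
  interval, \<open>N\<close> the modulus of a block. Distinct end points within a block
  (\<open>inj\<close>) yield definiteness of the norm; a dense supply of generators of full order
  (\<open>dense\<close>) yields generating balls.\<close>

locale step_placement =
  fixes I :: "'i set" and n :: "'i \<Rightarrow> nat" and lab :: "'i \<Rightarrow> 'l" and pos :: "'i \<Rightarrow> real" and N :: "'l \<Rightarrow> nat"
  assumes n_gt_1: "\<forall>i\<in>I. n i > 1"
    and n_dvd: "i \<in> I \<Longrightarrow> n i dvd N (lab i)"
    and N_pos: "i \<in> I \<Longrightarrow> N (lab i) > 0"
    and inj: "inj_on (\<lambda>i. (lab i, pos i)) I"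
    and pos: "i \<in> I \<Longrightarrow> 0 < pos i" "i \<in> I \<Longrightarrow> pos i < 1"
    and dense: "i \<in> I \<Longrightarrow> 0 \<le> a \<Longrightarrow> a < b \<Longrightarrow> b \<le> 1 \<Longrightarrow>
      \<exists>j\<in>I. lab j = lab i \<and> n j = N (lab i) \<and> a < pos j \<and> pos j < b"
begin

abbreviation "C \<equiv> zmod_sum I n"

text \<open>The generator \<open>i\<close> stands for \<open>N (lab i) div n i\<close> times the indicator function of
  \<open>(0, pos i)\<close>, with values modulo \<open>N (lab i)\<close>.\<close>

definition term_at :: "'l \<Rightarrow> real \<Rightarrow> 'i \<Rightarrow> int" where
  "term_at l t i = (if lab i = l \<and> t < pos i then int (N l div n i) else 0)"

definition val :: "'l \<Rightarrow> real \<Rightarrow> ('i \<Rightarrow> int) \<Rightarrow> int" where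
  "val l t f = (\<Sum>i | i \<in> I \<and> f i \<noteq> 0. f i * term_at l t i) mod int (N l)"

definition supp :: "'l \<Rightarrow> ('i \<Rightarrow> int) \<Rightarrow> real set" where
  "supp l f = {t \<in> {0<..<1}. val l t f \<noteq> 0}"

text \<open>All supports lie in \<open>(0, 1)\<close>, so the supremum over blocks is
  finite.\<close>

definition nu :: "('i \<Rightarrow> int) \<Rightarrow> real" where
  "nu f = (SUP l. measure lborel (supp l f))"

lemma n_gt_0: "\<forall>i\<in>I. n i > 0"
  using n_gt_1 by fastforce

lemma carrier_C: "f \<in> carrier C \<longleftrightarrow> f \<in> extensional I \<and> (\<forall>i\<in>I. 0 \<le> f i \<and> f i < int (n i)) \<and> finite {i \<in> I. f i \<noteq> 0}"
  by (rule carrier_zmod_sum[OF n_gt_0])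

lemma finite_support: "f \<in> carrier C \<Longrightarrow> finite {i \<in> I. f i \<noteq> 0}"
  by (simp add: carrier_C)

lemma term_at_dvd: "i \<in> I \<Longrightarrow> int (N l) dvd int (n i) * term_at l t i"
  using n_dvd[of i] by (auto simp: term_at_def dvd_mult_div_cancel simp flip: of_nat_mult)

lemma val_superset:
  assumes "finite S" "S \<subseteq> I" "{i \<in> I. f i \<noteq> 0} \<subseteq> S"
  shows "val l t f = (\<Sum>i\<in>S. f i * term_at l t i) mod int (N l)"
  unfolding val_def using assms by (intro arg_cong[where f = "\<lambda>x. x mod _"] sum.mono_neutral_left) auto

text \<open>Reducing the \<open>i\<close>-th coefficient modulo \<open>n i\<close> changes the sum
  by a multiple of \<open>n i * (N l div n i) = N l\<close>.\<close>

lemma val_hom: "val l t \<in> hom C (integer_mod_group (N l))"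
proof (rule homI)
  show "val l t f \<in> carrier (integer_mod_group (N l))" for f
    by (simp add: val_def carrier_integer_mod_group)
  fix f g assume f: "f \<in> carrier C" and g: "g \<in> carrier C"
  let ?S = "{i \<in> I. f i \<noteq> 0} \<union> {i \<in> I. g i \<noteq> 0}"
  let ?h = "\<lambda>i\<in>I. (f i + g i) mod int (n i)"
  have S: "finite ?S" "?S \<subseteq> I" using f g by (auto simp: finite_support)
  have sub: "{i \<in> I. f i \<noteq> 0} \<subseteq> ?S" "{i \<in> I. g i \<noteq> 0} \<subseteq> ?S" "{i \<in> I. ?h i \<noteq> 0} \<subseteq> ?S" by auto
  have "int (N l) dvd (\<Sum>i\<in>?S. ?h i * term_at l t i - (f i + g i) * term_at l t i)"
  proof (rule dvd_sum)
    fix i assume "i \<in> ?S"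
    then have i: "i \<in> I" by blast
    let ?q = "(f i + g i) div int (n i)"
    have hi: "?h i = (f i + g i) - int (n i) * ?q"
      using i by (simp add: minus_mult_div_eq_mod)
    have "?h i * term_at l t i - (f i + g i) * term_at l t i = - ?q * (int (n i) * term_at l t i)"
      unfolding hi by (simp add: algebra_simps)
    then show "int (N l) dvd ?h i * term_at l t i - (f i + g i) * term_at l t i"
      using term_at_dvd[OF i, of l t] by simp
  qed
  then have "(\<Sum>i\<in>?S. ?h i * term_at l t i) mod int (N l) = (\<Sum>i\<in>?S. (f i + g i) * term_at l t i) mod int (N l)"
    by (simp add: sum_subtractf mod_eq_dvd_iff)
  also have "\<dots> = ((\<Sum>i\<in>?S. f i * term_at l t i) mod int (N l) + (\<Sum>i\<in>?S. g i * term_at l t i) mod int (N l)) mod int (N l)"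
    by (simp add: distrib_right sum.distrib mod_add_eq)
  finally show "val l t (f \<otimes>\<^bsub>C\<^esub> g) = val l t f \<otimes>\<^bsub>integer_mod_group (N l)\<^esub> val l t g"
    unfolding mult_zmod_sum val_superset[OF S sub(1)] val_superset[OF S sub(2)] val_superset[OF S sub(3)]
    by simp
qed

sublocale C: comm_group C
  by (rule comm_group_zmod_sum)

lemma val_mult: "f \<in> carrier C \<Longrightarrow> g \<in> carrier C \<Longrightarrow> val l t (f \<otimes>\<^bsub>C\<^esub> g) = (val l t f + val l t g) mod int (N l)"
  using hom_mult[OF val_hom] by simp

lemma val_group_hom: "group_hom C (integer_mod_group (N l)) (val l t)"
  using val_hom by (simp add: group_hom_def group_hom_axioms_def)

lemma val_inv: "f \<in> carrier C \<Longrightarrow> val l t (inv\<^bsub>C\<^esub> f) = (- val l t f) mod int (N l)"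
  using group_hom.hom_inv[OF val_group_hom] hom_in_carrier[OF val_hom] by simp

lemma val_pow: "f \<in> carrier C \<Longrightarrow> val l t (f [^]\<^bsub>C\<^esub> (k::nat)) = (int k * val l t f) mod int (N l)"
  using group_hom.hom_nat_pow[OF val_group_hom] by simp

lemma val_mod: "val l t f mod int (N l) = val l t f"
  by (simp add: val_def)

lemma val_unit_vec: "i \<in> I \<Longrightarrow> val l t (unit_vec I i) = term_at l t i mod int (N l)"
  by (subst val_superset[of "{i}"]) (auto simp: unit_vec_def)

text \<open>The value at \<open>t\<close> depends only on which of the finitely many relevant
  positions exceed \<open>t\<close>; the support is a finite union of sets cut out by such patterns
  \<open>T\<close>.\<close>

lemma supp_measurable:
  assumes f: "f \<in> carrier C"
  shows "supp l f \<in> sets lborel"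
proof -
  let ?S = "{i \<in> I. f i \<noteq> 0}"
  let ?v = "\<lambda>T. (\<Sum>i\<in>?S. f i * (if lab i = l \<and> i \<in> T then int (N l div n i) else 0)) mod int (N l)"
  have v: "val l t f = ?v T" if "\<forall>i\<in>?S. t < pos i \<longleftrightarrow> i \<in> T" for t T
    unfolding val_def term_at_def using that
    by (intro arg_cong[where f = "\<lambda>x. x mod _"] sum.cong) auto
  have "supp l f = (\<Union>T\<in>{T \<in> Pow ?S. ?v T \<noteq> 0}. {t \<in> {0<..<1}. \<forall>i\<in>?S. t < pos i \<longleftrightarrow> i \<in> T})" (is "_ = ?R")
  proof (intro equalityI subsetI)
    fix t assume t: "t \<in> supp l f"
    let ?T = "{i \<in> ?S. t < pos i}"
    have "\<forall>i\<in>?S. t < pos i \<longleftrightarrow> i \<in> ?T" by blast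
    moreover from v[OF this] have "?T \<in> {T \<in> Pow ?S. ?v T \<noteq> 0}" using t by (simp add: supp_def) blast
    ultimately show "t \<in> ?R" using t unfolding supp_def by blast
  next
    fix t assume "t \<in> ?R"
    then obtain T where T: "?v T \<noteq> 0" "t \<in> {0<..<1}" "\<forall>i\<in>?S. t < pos i \<longleftrightarrow> i \<in> T" by blast
    then show "t \<in> supp l f" using v[OF T(3)] unfolding supp_def by simp
  qed
  moreover have "?R \<in> sets lborel"
  proof (rule sets.finite_UN)
    show "finite {T \<in> Pow ?S. ?v T \<noteq> 0}" using finite_support[OF f] by simp
    fix T
    have "{t \<in> space borel. \<forall>i\<in>?S. t < pos i \<longleftrightarrow> i \<in> T} \<in> sets borel"
    proof (rule sets.sets_Collect_finite_All[OF _ finite_support[OF f]])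
      fix i show "{t \<in> space borel. t < pos i \<longleftrightarrow> i \<in> T} \<in> sets borel"
        by (cases "i \<in> T") (simp_all flip: lessThan_def atLeast_def add: not_less)
    qed
    moreover have "{t \<in> {0<..<1}. \<forall>i\<in>?S. t < pos i \<longleftrightarrow> i \<in> T} =
      {0<..<1} \<inter> {t \<in> space borel. \<forall>i\<in>?S. t < pos i \<longleftrightarrow> i \<in> T}" by auto
    ultimately show "{t \<in> {0<..<1}. \<forall>i\<in>?S. t < pos i \<longleftrightarrow> i \<in> T} \<in> sets lborel" by simp
  qed
  ultimately show ?thesis by simp
qed

lemma supp_fmeasurable: "f \<in> carrier C \<Longrightarrow> supp l f \<in> fmeasurable lborel"
  by (rule fmeasurableI2[OF _ _ supp_measurable, of "{0<..<1}"]) (auto simp: supp_def intro: fmeasurableI)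

lemma measure_supp_le:
  assumes "f \<in> carrier C" "supp l f \<subseteq> {a..<b}" "a \<le> b"
  shows "measure lborel (supp l f) \<le> b - a"
proof -
  have "measure lborel (supp l f) \<le> measure lborel {a..<b}"
    by (rule measure_mono_fmeasurable[OF assms(2) supp_measurable[OF assms(1)]])
      (use assms(3) in \<open>auto intro: fmeasurableI\<close>)
  then show ?thesis using assms(3) by simp
qed

lemma nu_upper: "f \<in> carrier C \<Longrightarrow> measure lborel (supp l f) \<le> nu f"
  unfolding nu_def
proof (rule cSUP_upper)
  assume f: "f \<in> carrier C"
  have "measure lborel (supp l f) \<le> 1 - 0" for l
    by (rule measure_supp_le[OF f]) (auto simp: supp_def)
  then show "bdd_above (range (\<lambda>l. measure lborel (supp l f)))" by (intro bdd_aboveI[of _ 1]) auto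
qed simp

lemma nu_least: "(\<And>l. measure lborel (supp l f) \<le> c) \<Longrightarrow> nu f \<le> c"
  unfolding nu_def by (rule cSUP_least) auto

lemma nu_nonneg: "f \<in> carrier C \<Longrightarrow> 0 \<le> nu f"
  using nu_upper[of f undefined] measure_nonneg[of lborel "supp undefined f"] by linarith

lemma nu_one: "nu \<one>\<^bsub>C\<^esub> = 0"
proof -
  have "supp l \<one>\<^bsub>C\<^esub> = {}" for l
    using group_hom.hom_one[OF val_group_hom] by (simp add: supp_def)
  then have "nu \<one>\<^bsub>C\<^esub> \<le> 0" by (intro nu_least) simp
  then show ?thesis using nu_nonneg[of "\<one>\<^bsub>C\<^esub>"] by simp
qed

lemma nu_inv: "f \<in> carrier C \<Longrightarrow> nu (inv\<^bsub>C\<^esub> f) = nu f"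
proof -
  assume f: "f \<in> carrier C"
  have "val l t (inv\<^bsub>C\<^esub> f) = 0 \<longleftrightarrow> val l t f = 0" for l t
    using val_mod[of l t f] by (simp add: val_inv[OF f] mod_eq_0_iff_dvd) (simp add: dvd_eq_mod_eq_0)
  then show ?thesis by (simp add: nu_def supp_def)
qed

lemma nu_mult:
  assumes "f \<in> carrier C" "g \<in> carrier C"
  shows "nu (f \<otimes>\<^bsub>C\<^esub> g) \<le> nu f + nu g"
proof (rule nu_least)
  fix l
  have "supp l (f \<otimes>\<^bsub>C\<^esub> g) \<subseteq> supp l f \<union> supp l g"
    by (auto simp: supp_def val_mult[OF assms])
  then have "measure lborel (supp l (f \<otimes>\<^bsub>C\<^esub> g)) \<le> measure lborel (supp l f \<union> supp l g)"
    using assms supp_measurable supp_fmeasurable by (intro measure_mono_fmeasurable) auto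
  also have "\<dots> \<le> measure lborel (supp l f) + measure lborel (supp l g)"
    using assms supp_measurable by (intro measure_Un_le)
  also have "\<dots> \<le> nu f + nu g" using assms nu_upper by (intro add_mono)
  finally show "measure lborel (supp l (f \<otimes>\<^bsub>C\<^esub> g)) \<le> nu f + nu g" .
qed

text \<open>Just below the largest position carrying a nonzero coefficient, the step function has only
  that one contribution.\<close>

lemma nu_definite:
  assumes f: "f \<in> carrier C" "nu f = 0"
  shows "f = \<one>\<^bsub>C\<^esub>"
proof (rule ccontr)
  assume neq: "f \<noteq> \<one>\<^bsub>C\<^esub>"
  have fc: "f \<in> extensional I" "\<And>i. i \<in> I \<Longrightarrow> 0 \<le> f i \<and> f i < int (n i)" using f(1) carrier_C by auto
  have "\<exists>i\<in>I. f i \<noteq> 0"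
  proof (rule ccontr)
    assume "\<not> (\<exists>i\<in>I. f i \<noteq> 0)"
    then have "f = \<one>\<^bsub>C\<^esub>" unfolding one_zmod_sum using fc(1) by (intro extensionalityI[of _ I]) auto
    with neq show False by contradiction
  qed
  then obtain i0 where i0: "i0 \<in> I" "f i0 \<noteq> 0" by blast
  define l where "l = lab i0"
  define S where "S = {i \<in> I. f i \<noteq> 0 \<and> lab i = l}"
  have fin: "finite S" using finite_support[OF f(1)] by (rule rev_finite_subset) (auto simp: S_def)
  have ne: "S \<noteq> {}" using i0 by (auto simp: S_def l_def)
  have "Max (pos ` S) \<in> pos ` S" using fin ne by (intro Max_in) auto
  then obtain i where "i \<in> S" "pos i = Max (pos ` S)" by auto
  then have i: "i \<in> S" "\<And>j. j \<in> S \<Longrightarrow> pos j \<le> pos i" using fin by auto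
  \<comment> \<open>The next lower position in the block, or \<open>0\<close> if there is none; on
    \<open>(s, pos i)\<close> only the summand \<open>i\<close> contributes.\<close>
  define s where "s = Max (insert 0 (pos ` (S - {i})))"
  have iI: "i \<in> I" "f i \<noteq> 0" "lab i = l" using i(1) by (auto simp: S_def)
  have lt: "pos j < pos i" if "j \<in> S - {i}" for j
  proof -
    have "pos j \<noteq> pos i"
      using inj_onD[OF inj, of j i] that iI by (auto simp: S_def)
    then show ?thesis using i(2)[of j] that by simp
  qed
  have s: "0 \<le> s" "s < pos i" using fin lt pos(1)[OF iI(1)] by (auto simp: s_def)
  have sj: "pos j \<le> s" if "j \<in> S - {i}" for j using fin that by (auto simp: s_def)
  have "{s<..<pos i} \<subseteq> supp l f"
  proof
    fix t assume t: "t \<in> {s<..<pos i}"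
    have "(\<Sum>j | j \<in> I \<and> f j \<noteq> 0. f j * term_at l t j) = (\<Sum>j\<in>{i}. f j * term_at l t j)"
    proof (rule sum.mono_neutral_right)
      show "finite {j. j \<in> I \<and> f j \<noteq> 0}" by (rule finite_support[OF f(1)])
      show "{i} \<subseteq> {j. j \<in> I \<and> f j \<noteq> 0}" using iI by simp
      show "\<forall>j\<in>{j. j \<in> I \<and> f j \<noteq> 0} - {i}. f j * term_at l t j = 0"
      proof
        fix j assume j: "j \<in> {j. j \<in> I \<and> f j \<noteq> 0} - {i}"
        have "\<not> t < pos j" if "lab j = l" using sj[of j] j that t by (simp add: S_def)
        then show "f j * term_at l t j = 0" by (cases "lab j = l") (simp_all add: term_at_def)
      qed
    qed
    then have val: "val l t f = (f i * int (N l div n i)) mod int (N l)"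
      using t iI by (simp add: val_def term_at_def)
    \<comment> \<open>Cancelling \<open>N l div n i\<close> would leave \<open>n i\<close> dividing
      \<open>f i\<close>, which lies strictly between \<open>0\<close> and
      \<open>n i\<close>.\<close>
    have "\<not> int (N l) dvd f i * int (N l div n i)"
    proof
      assume "int (N l) dvd f i * int (N l div n i)"
      moreover have N: "N l = n i * (N l div n i)" using n_dvd[OF iI(1)] iI(3) by simp
      ultimately have "int (n i) * int (N l div n i) dvd f i * int (N l div n i)"
        by (metis of_nat_mult)
      moreover have "N l div n i \<noteq> 0" using N N_pos[OF iI(1)] iI(3) by (metis mult_0_right less_irrefl)
      ultimately have "int (n i) dvd f i" by simp
      moreover have "0 < f i" "f i < int (n i)" using fc(2)[OF iI(1)] iI(2) by auto
      ultimately show False using zdvd_not_zless by blast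
    qed
    then show "t \<in> supp l f" using val t s pos(2)[OF iI(1)] by (simp add: supp_def mod_eq_0_iff_dvd)
  qed
  then have "measure lborel {s<..<pos i} \<le> measure lborel (supp l f)"
    using supp_fmeasurable[OF f(1)] by (intro measure_mono_fmeasurable) auto
  also have "\<dots> \<le> 0" using nu_upper[OF f(1)] f(2) by simp
  finally show False using s(2) by simp
qed

section \<open>Elements of small norm and generation by balls\<close>

lemma unit_vec_in_C: "i \<in> I \<Longrightarrow> unit_vec I i \<in> carrier C"
  by (rule unit_vec_closed[OF n_gt_1])

lemma nu_unit_vec:
  assumes "i \<in> I"
  shows "nu (unit_vec I i) \<le> pos i"
proof (rule nu_least)
  fix l
  have "supp l (unit_vec I i) \<subseteq> {0..<pos i}"
    using assms by (auto simp: supp_def val_unit_vec term_at_def split: if_splits)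
  then show "measure lborel (supp l (unit_vec I i)) \<le> pos i"
    using measure_supp_le[OF unit_vec_in_C[OF assms]] pos(1)[OF assms] by fastforce
qed

text \<open>As \<open>n j\<close> is the full modulus, generator \<open>j\<close> is the plain
  indicator function of \<open>(0, pos j)\<close>; its multiple by \<open>N (lab i) div n i\<close>
  cancels generator \<open>i\<close> there and leaves only the stretch between the two end
  points.\<close>

lemma nu_unit_vec_diff:
  assumes i: "i \<in> I" and j: "j \<in> I" "lab j = lab i" "n j = N (lab i)" "pos j < pos i"
  shows "nu (unit_vec I i \<otimes>\<^bsub>C\<^esub> inv\<^bsub>C\<^esub> (unit_vec I j [^]\<^bsub>C\<^esub> (N (lab i) div n i))) \<le> pos i - pos j"
proof (rule nu_least)
  fix l
  let ?k = "N (lab i) div n i"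
  let ?w = "unit_vec I i \<otimes>\<^bsub>C\<^esub> inv\<^bsub>C\<^esub> (unit_vec I j [^]\<^bsub>C\<^esub> ?k)"
  have w: "?w \<in> carrier C" using unit_vec_in_C i j(1) by simp
  have val: "val l t ?w = (term_at l t i - int ?k * term_at l t j) mod int (N l)" for t
    using unit_vec_in_C i j(1)
    by (simp add: val_mult val_inv val_pow val_unit_vec mod_simps)
  have "N (lab i) div n j = 1" using j(3) N_pos[OF i] by simp
  then have zero: "val l t ?w = 0" if "\<not> (pos j \<le> t \<and> t < pos i)" for t
    using that j(2,4) unfolding val by (auto simp: term_at_def)
  have "supp l ?w \<subseteq> {pos j..<pos i}"
  proof
    fix t assume "t \<in> supp l ?w"
    then have "val l t ?w \<noteq> 0" unfolding supp_def by blast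
    then have "pos j \<le> t \<and> t < pos i" using zero by blast
    then show "t \<in> {pos j..<pos i}" by simp
  qed
  then show "measure lborel (supp l ?w) \<le> pos i - pos j"
    using measure_supp_le[OF w] j(4) by fastforce
qed

text \<open>Induction on \<open>k\<close> for positions below \<open>k \<epsilon>\<close>: up to an
  element of the ball, generator \<open>i\<close> is a multiple of a full-order generator
  \<open>j\<close> less than \<open>\<epsilon>\<close> to its left, to which the induction
  hypothesis applies.\<close>

lemma ball_generates:
  assumes \<epsilon>: "\<epsilon> > 0" and H: "subgroup H C" and ball: "{f \<in> carrier C. nu f < \<epsilon>} \<subseteq> H"
  shows "H = carrier C"
proof (rule subgroup_zmod_sum_eqI[OF n_gt_1 H])
  have "\<forall>i\<in>I. pos i < real k * \<epsilon> \<longrightarrow> unit_vec I i \<in> H" for k :: nat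
  proof (induction k)
    case 0
    then show ?case using pos(1) by fastforce
  next
    case (Suc k)
    show ?case
    proof (intro ballI impI)
      fix i assume i: "i \<in> I" "pos i < real (Suc k) * \<epsilon>"
      show "unit_vec I i \<in> H"
      proof (cases "pos i < \<epsilon>")
        case True
        then have "nu (unit_vec I i) < \<epsilon>" using nu_unit_vec[OF i(1)] by simp
        then show ?thesis using ball unit_vec_in_C[OF i(1)] by blast
      next
        case False
        have k: "k > 0" using False i(2) by (cases k) auto
        \<comment> \<open>The window for \<open>pos j\<close>: less than \<open>\<epsilon>\<close>
          below \<open>pos i\<close>, and below \<open>k \<epsilon>\<close>. It is nonempty because
          \<open>pos i < (k + 1) \<epsilon>\<close> and \<open>k > 0\<close>.\<close>
        have "max 0 (pos i - \<epsilon>) < min (pos i) (real k * \<epsilon>)"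
          using i(2) \<epsilon> k pos(1)[OF i(1)] by (simp add: algebra_simps)
        moreover have "min (pos i) (real k * \<epsilon>) \<le> 1" using pos(2)[OF i(1)] by simp
        ultimately obtain j where j: "j \<in> I" "lab j = lab i" "n j = N (lab i)"
            "max 0 (pos i - \<epsilon>) < pos j" "pos j < min (pos i) (real k * \<epsilon>)"
          using dense[OF i(1), of "max 0 (pos i - \<epsilon>)" "min (pos i) (real k * \<epsilon>)"] by auto
        let ?u = "unit_vec I j [^]\<^bsub>C\<^esub> (N (lab i) div n i)"
        let ?w = "unit_vec I i \<otimes>\<^bsub>C\<^esub> inv\<^bsub>C\<^esub> ?u"
        have c: "unit_vec I i \<in> carrier C" "?u \<in> carrier C" using unit_vec_in_C i(1) j(1) by simp_all
        have "unit_vec I j \<in> H" using Suc j(1,5) by simp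
        then have u: "?u \<in> H" using C.subgroup_int_pow_closed[OF H] by (metis int_pow_int)
        have "nu ?w < \<epsilon>" using nu_unit_vec_diff[OF i(1) j(1-3)] j(4,5) by simp
        then have "?w \<in> H" using ball c by auto
        then have "?w \<otimes>\<^bsub>C\<^esub> ?u \<in> H" using u by (rule subgroup.m_closed[OF H])
        moreover have "?w \<otimes>\<^bsub>C\<^esub> ?u = unit_vec I i" using c by (simp add: C.m_assoc)
        ultimately show ?thesis by simp
      qed
    qed
  qed
  note mem = this
  fix i assume i: "i \<in> I"
  obtain k :: nat where "pos i < real k * \<epsilon>" using reals_Archimedean3[OF \<epsilon>] by blast
  then show "unit_vec I i \<in> H" using mem i by blast
qed

end

subsection \<open>Distribution of the summands over blocks\<close>

lemma infinite_Rats_greaterThanLessThan: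
  fixes a b :: real
  assumes "a < b"
  shows "infinite (\<rat> \<inter> {a<..<b})"
proof
  assume fin: "finite (\<rat> \<inter> {a<..<b})"
  obtain r where "r \<in> \<rat>" "a < r" "r < b" using Rats_dense_in_real[OF assms] by blast
  then have "Max (\<rat> \<inter> {a<..<b}) \<in> \<rat> \<inter> {a<..<b}" using fin by (intro Max_in) auto
  then have m: "a < Max (\<rat> \<inter> {a<..<b})" "Max (\<rat> \<inter> {a<..<b}) < b" by auto
  obtain s where s: "s \<in> \<rat>" "Max (\<rat> \<inter> {a<..<b}) < s" "s < b" using Rats_dense_in_real[OF m(2)] by blast
  then have "s \<le> Max (\<rat> \<inter> {a<..<b})" using m(1) fin by (intro Max_ge) auto
  with s(2) show False by simp
qed

text \<open>An enumeration of the rationals in \<open>(0, 1)\<close>. Infinitely many hits in each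
  interval leave room to discard the finitely many summands of exceptional order.\<close>

lemma ex_dense_positions:
  "\<exists>q :: nat \<Rightarrow> real. inj q \<and> (\<forall>k. 0 < q k \<and> q k < 1) \<and>
     (\<forall>a b. 0 \<le> a \<longrightarrow> a < b \<longrightarrow> b \<le> 1 \<longrightarrow> infinite {k. a < q k \<and> q k < b})"
proof -
  let ?Q = "\<rat> \<inter> {0<..<1::real}"
  define q where "q = from_nat_into ?Q"
  have "countable ?Q" by (rule countable_subset[OF _ countable_rat]) auto
  then have bij: "bij_betw q UNIV ?Q"
    unfolding q_def by (intro bij_betw_from_nat_into infinite_Rats_greaterThanLessThan) simp_all
  have "infinite {k. a < q k \<and> q k < b}" if "0 \<le> a" "a < b" "b \<le> 1" for a b
  proof
    assume "finite {k. a < q k \<and> q k < b}"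
    then have "finite (q ` {k. a < q k \<and> q k < b})" by (rule finite_imageI)
    moreover have "\<rat> \<inter> {a<..<b} \<subseteq> q ` {k. a < q k \<and> q k < b}"
    proof
      fix r assume r: "r \<in> \<rat> \<inter> {a<..<b}"
      then have "r \<in> range q" using that bij by (auto simp: bij_betw_def)
      then show "r \<in> q ` {k. a < q k \<and> q k < b}" using r by auto
    qed
    ultimately show False using infinite_Rats_greaterThanLessThan[OF that(2)] finite_subset by blast
  qed
  moreover have "inj q" using bij by (simp add: bij_betw_def)
  moreover have "0 < q k \<and> q k < 1" for k using bij by (auto simp: bij_betw_def)
  ultimately show ?thesis by blast
qed

text \<open>\<open>\<kappa>\<close> sorts the summands into infinite classes. A class
  \<open>K\<close> is equipotent to \<open>K \<times> nat\<close>, so it splits into countable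
  blocks, each receiving every position of a dense sequence. All but finitely many summands of a
  class have order \<open>M\<close>, so these remain dense in each block.\<close>

lemma ex_step_placement:
  fixes I :: "'i set" and n :: "'i \<Rightarrow> nat" and \<kappa> :: "'i \<Rightarrow> 'k" and M :: "'k \<Rightarrow> nat"
  assumes n: "\<forall>i\<in>I. n i > 1" and M: "\<forall>i\<in>I. n i dvd M (\<kappa> i)" "\<forall>i\<in>I. M (\<kappa> i) > 0"
    and inf: "\<forall>i\<in>I. infinite {j \<in> I. \<kappa> j = \<kappa> i}"
    and fin: "\<forall>i\<in>I. finite {j \<in> I. \<kappa> j = \<kappa> i \<and> n j \<noteq> M (\<kappa> i)}"
  shows "\<exists>(lab :: 'i \<Rightarrow> 'k \<times> 'i) pos. step_placement I n lab pos (M \<circ> fst)"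
proof -
  obtain q :: "nat \<Rightarrow> real" where q: "inj q" "\<And>k. 0 < q k \<and> q k < 1"
    and dense: "\<And>a b. 0 \<le> a \<Longrightarrow> a < b \<Longrightarrow> b \<le> 1 \<Longrightarrow> infinite {k. a < q k \<and> q k < b}"
    using ex_dense_positions by blast
  define K where "K k = {j \<in> I. \<kappa> j = k}" for k
  have "\<exists>\<beta>. bij_betw \<beta> (K k) (K k \<times> (UNIV :: nat set))" if "infinite (K k)" for k
    unfolding card_of_ordIso using that infinite_iff_card_of_nat
    by (intro card_of_Times_infinite_simps(2)) auto
  then obtain \<beta> where \<beta>: "\<And>k. infinite (K k) \<Longrightarrow> bij_betw (\<beta> k) (K k) (K k \<times> (UNIV :: nat set))"
    by metis
  have bij: "bij_betw (\<beta> (\<kappa> i)) (K (\<kappa> i)) (K (\<kappa> i) \<times> UNIV)" if "i \<in> I" for i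
    using \<beta> inf that by (simp add: K_def)
  \<comment> \<open>The first coordinate under \<open>\<beta>\<close> names the block inside the
    class and the second gives the position, so the modulus \<open>M \<circ> fst\<close> depends on
    the class only.\<close>
  define lab where "lab i = (\<kappa> i, fst (\<beta> (\<kappa> i) i))" for i
  define pos where "pos i = q (snd (\<beta> (\<kappa> i) i))" for i
  have "step_placement I n lab pos (M \<circ> fst)"
  proof
    show "inj_on (\<lambda>i. (lab i, pos i)) I"
    proof (rule inj_onI)
      fix i j assume ij: "i \<in> I" "j \<in> I" "(lab i, pos i) = (lab j, pos j)"
      then have \<kappa>: "\<kappa> i = \<kappa> j" by (simp add: lab_def)
      then have "\<beta> (\<kappa> i) i = \<beta> (\<kappa> i) j"
        using ij(3) injD[OF q(1)] by (auto simp: lab_def pos_def prod_eq_iff)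
      moreover have "i \<in> K (\<kappa> i)" "j \<in> K (\<kappa> i)" using ij \<kappa> by (auto simp: K_def)
      ultimately show "i = j" using bij[OF ij(1)] by (auto simp: bij_betw_def dest: inj_onD)
    qed
  next
    fix i and a b :: real assume i: "i \<in> I" and ab: "0 \<le> a" "a < b" "b \<le> 1"
    let ?k = "\<kappa> i"
    let ?s = "fst (\<beta> ?k i)"
    have "\<beta> ?k i \<in> K ?k \<times> UNIV" using bij_betwE[OF bij[OF i]] i by (auto simp: K_def)
    then have s: "?s \<in> K ?k" by (auto simp: mem_Times_iff)
    define J where "J = the_inv_into (K ?k) (\<beta> ?k) ` ({?s} \<times> {k. a < q k \<and> q k < b})"
    have "inj_on (the_inv_into (K ?k) (\<beta> ?k)) (K ?k \<times> UNIV)"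
      using bij_betw_the_inv_into[OF bij[OF i]] by (simp add: bij_betw_def)
    then have "inj_on (the_inv_into (K ?k) (\<beta> ?k)) ({?s} \<times> {k. a < q k \<and> q k < b})"
      by (rule inj_on_subset) (use s in auto)
    moreover have "infinite ({?s} \<times> {k. a < q k \<and> q k < b})"
      using dense[OF ab] finite_cartesian_productD2[of "{?s}"] by blast
    ultimately have "infinite J" unfolding J_def by (simp add: finite_image_iff)
    have J: "j \<in> K ?k \<and> fst (\<beta> ?k j) = ?s \<and> a < q (snd (\<beta> ?k j)) \<and> q (snd (\<beta> ?k j)) < b" if jJ: "j \<in> J" for j
    proof -
      obtain k where k: "j = the_inv_into (K ?k) (\<beta> ?k) (?s, k)" "a < q k" "q k < b"
        using jJ unfolding J_def by blast
      have sk: "(?s, k) \<in> K ?k \<times> UNIV" using s by simp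
      have "j \<in> K ?k" unfolding k(1) using bij_betwE[OF bij_betw_the_inv_into[OF bij[OF i]]] sk by blast
      moreover have "\<beta> ?k j = (?s, k)"
        unfolding k(1) by (rule f_the_inv_into_f_bij_betw[OF bij[OF i]]) (rule sk)
      ultimately show ?thesis using k by simp
    qed
    \<comment> \<open>Infinitely many members of the block have positions in \<open>(a, b)\<close>,
      so one escapes the finite exceptional set.\<close>
    have "\<not> J \<subseteq> {j \<in> I. \<kappa> j = ?k \<and> n j \<noteq> M ?k}"
      using fin i \<open>infinite J\<close> finite_subset by blast
    then obtain j where j: "j \<in> J" "n j = M ?k" using J by (auto simp: K_def)
    then show "\<exists>j\<in>I. lab j = lab i \<and> n j = (M \<circ> fst) (lab i) \<and> a < pos j \<and> pos j < b"
      using J[OF j(1)] by (intro bexI[of _ j]) (auto simp: K_def lab_def pos_def)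
  qed (use n M q(2) in \<open>auto simp: lab_def pos_def\<close>)
  then show ?thesis by blast
qed

lemma (in comm_group) ex_minimally_almost_periodic:
  assumes bdd: "bounded_group G" and dec: "cyclic_decomposition G P m A"
    and inf: "\<forall>p\<in>P. infinite (A p (m p))"
  shows "\<exists>T. group_topology G T \<and> Hausdorff_space T \<and> minimally_almost_periodic G T"
proof -
  define I where "I = (SIGMA p:P. SIGMA i:{1..m p}. A p i)"
  define n where "n = (\<lambda>(p, i, _::'a). p ^ i :: nat)"
  \<comment> \<open>Summands with an infinite invariant stay with their order; those with a finite
    invariant join the leading class of the same prime, whose order is a multiple of theirs. Only
    finitely many \<open>i\<close> occur for each prime, so a class has finitely many
    exceptions.\<close>
  define \<kappa> where "\<kappa> = (\<lambda>(p, i, _::'a). (p, if infinite (A p i) then i else m p))"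
  define M where "M = (\<lambda>(p, j). p ^ j :: nat)"
  have P: "\<forall>q\<in>P. Factorial_Ring.prime q \<and> m q \<ge> 1"
    using dec by (simp add: cyclic_decomposition_def)
  have n1: "\<forall>t\<in>I. n t > 1"
  proof
    fix t assume "t \<in> I"
    then obtain q i x where "t = (q, i, x)" "Factorial_Ring.prime q" "1 \<le> i" using P by (auto simp: I_def)
    then show "n t > 1" using prime_gt_1_nat[of q] one_less_power[of q i] by (simp add: n_def)
  qed
  have "\<exists>(lab :: nat \<times> nat \<times> 'a \<Rightarrow> (nat \<times> nat) \<times> nat \<times> nat \<times> 'a) pos. step_placement I n lab pos (M \<circ> fst)"
  proof (rule ex_step_placement[OF n1])
    show "\<forall>t\<in>I. n t dvd M (\<kappa> t)" by (auto simp: I_def n_def M_def \<kappa>_def le_imp_power_dvd)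
    show "\<forall>t\<in>I. M (\<kappa> t) > 0" using P by (auto simp: I_def M_def \<kappa>_def prime_gt_0_nat)
    show "\<forall>t\<in>I. infinite {s \<in> I. \<kappa> s = \<kappa> t}"
    proof
      fix t assume "t \<in> I"
      then obtain p i x where t: "t = (p, i, x)" "p \<in> P" "i \<in> {1..m p}" by (auto simp: I_def)
      define j where "j = (if infinite (A p i) then i else m p)"
      have j: "infinite (A p j)" "j \<in> {1..m p}" using inf t P by (auto simp: j_def)
      have "(\<lambda>x. (p, j, x)) ` A p j \<subseteq> {s \<in> I. \<kappa> s = \<kappa> t}"
        using j t(1,2) by (auto simp: I_def \<kappa>_def j_def)
      moreover have "infinite ((\<lambda>x. (p, j, x)) ` A p j)"
        using j(1) by (subst finite_image_iff) (auto intro: inj_onI)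
      ultimately show "infinite {s \<in> I. \<kappa> s = \<kappa> t}" using finite_subset by blast
    qed
    show "\<forall>t\<in>I. finite {s \<in> I. \<kappa> s = \<kappa> t \<and> n s \<noteq> M (\<kappa> t)}"
    proof
      fix t assume "t \<in> I"
      then obtain p j where t: "\<kappa> t = (p, j)" by (cases "\<kappa> t") auto
      have "{s \<in> I. \<kappa> s = \<kappa> t \<and> n s \<noteq> M (\<kappa> t)} \<subseteq> {p} \<times> (SIGMA i:{i \<in> {1..m p}. finite (A p i)}. A p i)"
      proof
        fix s assume s: "s \<in> {s \<in> I. \<kappa> s = \<kappa> t \<and> n s \<noteq> M (\<kappa> t)}"
        obtain q i x where sq: "s = (q, i, x)" "i \<in> {1..m q}" "x \<in> A q i"
          using s unfolding I_def by blast
        have "\<kappa> s = (p, j)" using s t by simp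
        then have k: "q = p" "(if infinite (A q i) then i else m q) = j"
          unfolding sq(1) \<kappa>_def by (auto split: if_splits)
        have "q ^ i \<noteq> p ^ j" using s sq(1) t by (simp add: n_def M_def)
        then have "finite (A q i)" using k by (cases "finite (A q i)") auto
        then show "s \<in> {p} \<times> (SIGMA i:{i \<in> {1..m p}. finite (A p i)}. A p i)"
          using sq k(1) by simp
      qed
      moreover have "finite ({p} \<times> (SIGMA i:{i \<in> {1..m p}. finite (A p i)}. A p i))"
        by (intro finite_cartesian_product finite_SigmaI) auto
      ultimately show "finite {s \<in> I. \<kappa> s = \<kappa> t \<and> n s \<noteq> M (\<kappa> t)}" by (rule finite_subset)
    qed
  qed
  then obtain lab :: "nat \<times> nat \<times> 'a \<Rightarrow> (nat \<times> nat) \<times> nat \<times> nat \<times> 'a" and pos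
    where "step_placement I n lab pos (M \<circ> fst)" by blast
  then interpret S: step_placement I n lab pos "M \<circ> fst" .
  obtain \<phi> where \<phi>: "\<phi> \<in> iso G S.C"
    using dec unfolding cyclic_decomposition_def is_iso_def cyclic_sum_eq_zmod_sum I_def n_def by blast
  then have hom: "\<phi> \<in> hom G S.C" and inj: "inj_on \<phi> (carrier G)" and surj: "\<phi> ` carrier G = carrier S.C"
    by (auto simp: iso_def bij_betw_def)
  interpret h: group_hom G S.C \<phi>
    using hom by (simp add: group_hom_def group_hom_axioms_def)
  show ?thesis
  \<comment> \<open>The norm is pulled back along \<open>\<phi>\<close>: injectivity transfers
    definiteness, and surjectivity matches the balls of \<open>G\<close> with those of the direct
    sum.\<close>
  proof (rule minimally_almost_periodic_of_norm[OF bdd, of "\<lambda>x. S.nu (\<phi> x)"])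
    show "x = \<one>" if "x \<in> carrier G" "S.nu (\<phi> x) = 0" for x
      using S.nu_definite[of "\<phi> x"] that h.inj_on_one_iff inj by simp
    show "H = carrier G"
      if \<epsilon>: "\<epsilon> > 0" and H: "subgroup H G" and ball: "{x \<in> carrier G. S.nu (\<phi> x) < \<epsilon>} \<subseteq> H" for \<epsilon> H
    proof -
      have "{f \<in> carrier S.C. S.nu f < \<epsilon>} \<subseteq> \<phi> ` H" using ball unfolding surj[symmetric] by auto
      then have "\<phi> ` H = carrier S.C"
        by (rule S.ball_generates[OF \<epsilon> h.subgroup_img_is_subgroup[OF H]])
      then show ?thesis
        using inj_on_image_eq_iff[OF inj subgroup.subset[OF H] order_refl] surj by simp
    qed
  qed (simp_all add: S.nu_nonneg S.nu_one S.nu_inv S.nu_mult)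
qed

section \<open>The cycle of implications from (a) through (b) and (c) back to (a)\<close>

theorem theorem3p2:
  fixes G :: "('a, 'b) monoid_scheme"
  assumes "comm_group G" and "bounded_group G"
  shows "((\<exists>T. group_topology G T \<and> Hausdorff_space T \<and> minimally_almost_periodic G T)
            \<longleftrightarrow> zariski_connected G) \<and>
         (zariski_connected G
            \<longleftrightarrow> (\<forall>p \<kappa>. leading_UK_invariant G p \<kappa> \<longrightarrow> BNF_Cardinal_Arithmetic.cinfinite \<kappa>))"
proof -
  interpret comm_group G by (rule assms(1))
  have ab: "zariski_connected G"
    if "\<exists>T. group_topology G T \<and> Hausdorff_space T \<and> minimally_almost_periodic G T"
    using that minimally_almost_periodic_imp_power_images[OF assms(2)] zariski_connected_iff by blast
  have bc: "BNF_Cardinal_Arithmetic.cinfinite \<kappa>"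
    if "zariski_connected G" "leading_UK_invariant G p \<kappa>" for p \<kappa>
  proof -
    obtain P m A where "cyclic_decomposition G P m A" "p \<in> P" "\<kappa> = card_of (A p (m p))"
      using \<open>leading_UK_invariant G p \<kappa>\<close> unfolding leading_UK_invariant_def by blast
    moreover have "power_images_trivial_or_infinite G"
      using \<open>zariski_connected G\<close> zariski_connected_iff by blast
    ultimately show ?thesis
      using infinite_leading_index_set
      by (simp add: BNF_Cardinal_Arithmetic.cinfinite_def Field_card_of)
  qed
  have ca: "\<exists>T. group_topology G T \<and> Hausdorff_space T \<and> minimally_almost_periodic G T"
    if c: "\<forall>p \<kappa>. leading_UK_invariant G p \<kappa> \<longrightarrow> BNF_Cardinal_Arithmetic.cinfinite \<kappa>"
  proof -
    obtain P m and A :: "nat \<Rightarrow> nat \<Rightarrow> 'a set" where dec: "cyclic_decomposition G P m A"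
      using ex_cyclic_decomposition[OF assms(2)] by blast
    have "infinite (A p (m p))" if "p \<in> P" for p
    proof -
      have "leading_UK_invariant G p (card_of (A p (m p)))"
        unfolding leading_UK_invariant_def using dec that by blast
      then have "BNF_Cardinal_Arithmetic.cinfinite (card_of (A p (m p)))" using c by blast
      then show ?thesis by (simp add: BNF_Cardinal_Arithmetic.cinfinite_def Field_card_of)
    qed
    then show ?thesis using ex_minimally_almost_periodic[OF assms(2) dec] by blast
  qed
  show ?thesis using ab bc ca by blast
qed

end
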